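(* Let $\mathcal{F}=\{(f,c_n,\varphi_n):n\in\mathbb{N}\}$ be a family of physical design problems that satisfies the $(\alpha,\gamma)$-asymptotic convergence conditions with $\alpha>1/4$ and $\gamma<3\alpha$, and let $\varepsilon\in(0,1)$. For $n\in\mathbb{N}$, let $\Theta_n=\{\theta_n^1,\theta_n^2,\dots,\theta_n^{T_n}\}$ be the design parameters generated by gradient descent, under the assumption that it does not fail, when applied to $(f,c_n,\varphi_n)$ with step size $\eta_n\le O(n^{-3\gamma+\alpha-1})$ for $T_n$ steps starting with the initial design $\theta_n^0=0$. If all the sequences $\{\theta_n\in\Theta_n:n\in\mathbb{N}\}$ are non-resonant with respect to $\mathcal{F}$, then $$f\big(c_n^{\mathrm T}\varphi_n(\theta_n^{T_n})\big)-f^*\le\varepsilon$$ (for all sufficiently large $n$) for $T_n$ chosen such that $T_n=\Theta(n^{1-2(\alpha-\gamma)}\log(\varepsilon^{-1}))$, where $f^*=\min_{x\in\mathbb{R}}f(x)$.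
   Context: Norms: $\|v\|_p$ is the $l^p$ norm of a vector, $\|v\|=\|v\|_2$; $\|M\|_p$ is the induced $l^p$ operator norm of a matrix. $\odot$ is the elementwise product of vectors. Asymptotics (as $n\to\infty$): $a_n\le O(g(n))$ means there is $C>0$ with $a_n\le Cg(n)$ as $n\to\infty$; $a_n\ge\Omega(g(n))$ means there is $C>0$ with $a_n\ge Cg(n)$ as $n\to\infty$; $a_n=\Theta(g(n))$ means both. $n^{o(1)}$ denotes a function growing slower than $n^{\delta}$ for every $\delta>0$. Physical system: a physical system $\varphi\equiv(A,B,b)$ of state size $n$ and parameter size $m$ consists of $A\in\mathbb{R}^{n\times n}$, $B\in\mathbb{R}^{n\times m}$, $b\in\mathbb{R}^n$, with $\mathrm{dom}(\varphi)=\{\theta\in\mathbb{R}^m: A+\mathrm{diag}(B\theta)\text{ is invertible}\}$ and $\varphi(\theta)=(A+\mathrm{diag}(B\theta))^{-1}b$ for $\theta\in\mathrm{dom}(\varphi)$. For $c\in\mathbb{R}^n$, the adjoint system is $\mathrm{ad}[\varphi](\theta,c)=(A+\mathrm{diag}(B\theta))^{-\mathrm T}c$. Physical design problem: a tuple $(f,c,\varphi)$ with $f:\mathbb{R}\to\mathbb{R}$, $c\in\mathbb{R}^n$, $\varphi$ a physical system of state size $n$; the problem is to minimize $f(c^{\mathrm T}\varphi(\theta))$ over $\theta\in\mathrm{dom}(\varphi)$. A family of physical design problems is a sequence $\{(f,c_n,\varphi_n):n\in\mathbb{N}\}$ where $(f,c_n,\varphi_n)$ has state size $n$ and $f$ does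 not depend on $n$. $(\alpha,\gamma)$-asymptotic convergence conditions for $\{(f,c_n,\varphi_n\equiv(A_n,B_n,b_n))\}$: (a) $f$ is $L$-Lipschitz smooth (differentiable with $|f'(x)-f'(y)|\le L|x-y|$), $\mu$-strongly convex with $\mu>0$ ($f(y)\ge f(x)+f'(x)(y-x)+\frac{\mu}{2}|x-y|^2$), and bounded from below, $f^*=\min_{x\in\mathbb{R}}f(x)>-\infty$; (b) $\|A_n^{-1}\|_2\le O(n^\gamma)$; (c) $\|B_n\|_\infty,\|B_n\|_1,\|B_n\|_2\le O(1)$; (d) $\|b_n\|_\infty,\|b_n\|_1\le O(1)$; (e) $\|c_n\|_\infty,\|c_n\|_1\le O(1)$; (f) $\|B_n^{\mathrm T}(A_n^{-1}b_n\odot A_n^{-\mathrm T}c_n)\|_2^2\ge\Omega(n^{\alpha+\gamma})$; (g) $|c_n^{\mathrm T}A_n^{-1}b_n|\le O(1)$. Non-resonant: a sequence $\{\theta_n\in\mathrm{dom}(\varphi_n):n\in\mathbb{N}\}$ is non-resonant with respect to $\mathcal{F}=\{(f,c_n,\varphi_n)\}$ if $\|\varphi_n(\theta_n)\|_\infty\le O(n^{o(1)})$ and $\|\mathrm{ad}[\varphi_n](\theta_n,c_n)\|_\infty\le O(n^{o(1)})$. Gradient descent on $(f,c,\varphi)$ from $\theta^0$ with step size $\eta\in(0,\infty)$ for $T$ steps: for $t=1,\dots,T$, $\theta^t=\theta^{t-1}-\eta\,\nabla_\theta f(c^{\mathrm T}\varphi(\theta))|_{\theta=\theta^{t-1}}$,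 where $\nabla_\theta f(c^{\mathrm T}\varphi(\theta))=-f'(c^{\mathrm T}\varphi(\theta))\,B^{\mathrm T}(\varphi(\theta)\odot\mathrm{ad}[\varphi](\theta,c))$. It fails if $\theta^t\notin\mathrm{dom}(\varphi)$ for some $t$.
   Formalization: The step size is assumed to be exactly of order n^{-3γ+α-1} (a matching lower bound is added to η_n ≤ O(...)), since the claim fails for much smaller steps; T_n is any sequence of the stated order whose implied constant is large enough. *)

theory Defs
  imports
    "HOL-Analysis.Derivative"
    "Jordan_Normal_Form.Determinant"
    "Jordan_Normal_Form.Gauss_Jordan_Elimination"
    "HOL-Library.Landau_Symbols"
begin

unbundle no vec_syntax
unbundle no inner_syntax

subsection \<open>Norms\<close>

definition vnorm1 :: "real vec \<Rightarrow> real" where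
  "vnorm1 v = (\<Sum>i<dim_vec v. \<bar>v $ i\<bar>)"

definition vnorm2 :: "real vec \<Rightarrow> real" where
  "vnorm2 v = L2_set (\<lambda>i. v $ i) {..<dim_vec v}"

text \<open>The \<open>0\<close> is inserted only to give the empty vector norm \<open>0\<close>.\<close>
definition vnorm_inf :: "real vec \<Rightarrow> real" where
  "vnorm_inf v = Max (insert 0 ((\<lambda>i. \<bar>v $ i\<bar>) ` {..<dim_vec v}))"

text \<open>
  As in \<open>onorm\<close>, the vector \<open>x = 0\<close> contributes the quotient \<open>0 / 0 = 0\<close>.
\<close>
definition induced_norm :: "(real vec \<Rightarrow> real) \<Rightarrow> real mat \<Rightarrow> real" where
  "induced_norm N M = (SUP x \<in> carrier_vec (dim_col M). N (M *\<^sub>v x) / N x)"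

subsection \<open>Physical systems\<close>

text \<open>Meaningful only for invertible square \<open>M\<close>; see \<open>minv\<close> below.\<close>
definition minv :: "real mat \<Rightarrow> real mat" where
  "minv M = the (mat_inverse M)"

record phys_system =
  sysA :: "real mat"
  sysB :: "real mat"
  sysb :: "real vec"

definition physical_system :: "nat \<Rightarrow> nat \<Rightarrow> phys_system \<Rightarrow> bool" where
  "physical_system n m \<phi> \<longleftrightarrow>
     sysA \<phi> \<in> carrier_mat n n \<and> sysB \<phi> \<in> carrier_mat n m \<and> sysb \<phi> \<in> carrier_vec n"

definition sys_mat :: "phys_system \<Rightarrow> real vec \<Rightarrow> real mat" where
  "sys_mat \<phi> \<theta> =
     sysA \<phi> + mat_diag (dim_row (sysB \<phi>)) (\<lambda>i. (sysB \<phi> *\<^sub>v \<theta>) $ i)"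

definition sys_dom :: "phys_system \<Rightarrow> real vec set" where
  "sys_dom \<phi> = {\<theta> \<in> carrier_vec (dim_col (sysB \<phi>)). invertible_mat (sys_mat \<phi> \<theta>)}"

definition sys_state :: "phys_system \<Rightarrow> real vec \<Rightarrow> real vec" where
  "sys_state \<phi> \<theta> = minv (sys_mat \<phi> \<theta>) *\<^sub>v sysb \<phi>"

definition sys_adjoint :: "phys_system \<Rightarrow> real vec \<Rightarrow> real vec \<Rightarrow> real vec" where
  "sys_adjoint \<phi> \<theta> c = transpose_mat (minv (sys_mat \<phi> \<theta>)) *\<^sub>v c"

subsection \<open>Gradient descent\<close>

definition objective :: "(real \<Rightarrow> real) \<Rightarrow> real vec \<Rightarrow> phys_system \<Rightarrow> real vec \<Rightarrow> real" where
  "objective f c \<phi> \<theta> = f (c \<bullet> sys_state \<phi> \<theta>)"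

text \<open>
  The closed form of the gradient of \<^const>\<open>objective\<close> at a point of the domain; that it is the
  gradient is the lemma \<open>objective_directional_derivative\<close> below.
\<close>
definition objective_grad ::
    "(real \<Rightarrow> real) \<Rightarrow> real vec \<Rightarrow> phys_system \<Rightarrow> real vec \<Rightarrow> real vec" where
  "objective_grad f c \<phi> \<theta> =
     (- deriv f (c \<bullet> sys_state \<phi> \<theta>)) \<cdot>\<^sub>v
       (transpose_mat (sysB \<phi>) *\<^sub>v component_mult (sys_state \<phi> \<theta>) (sys_adjoint \<phi> \<theta> c))"

primrec gd_iter ::
    "(real \<Rightarrow> real) \<Rightarrow> real vec \<Rightarrow> phys_system \<Rightarrow> real \<Rightarrow> real vec \<Rightarrow> nat \<Rightarrow> real vec" where
  "gd_iter f c \<phi> \<eta> \<theta>0 0 = \<theta>0"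
| "gd_iter f c \<phi> \<eta> \<theta>0 (Suc t) =
     gd_iter f c \<phi> \<eta> \<theta>0 t - \<eta> \<cdot>\<^sub>v objective_grad f c \<phi> (gd_iter f c \<phi> \<eta> \<theta>0 t)"

definition gd_not_fail ::
    "(real \<Rightarrow> real) \<Rightarrow> real vec \<Rightarrow> phys_system \<Rightarrow> real \<Rightarrow> real vec \<Rightarrow> nat \<Rightarrow> bool" where
  "gd_not_fail f c \<phi> \<eta> \<theta>0 T \<longleftrightarrow> (\<forall>t\<le>T. gd_iter f c \<phi> \<eta> \<theta>0 t \<in> sys_dom \<phi>)"

text \<open>The starting point is not among the generated designs.\<close>
definition gd_designs ::
    "(real \<Rightarrow> real) \<Rightarrow> real vec \<Rightarrow> phys_system \<Rightarrow> real \<Rightarrow> real vec \<Rightarrow> nat \<Rightarrow> real vec set" where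
  "gd_designs f c \<phi> \<eta> \<theta>0 T = gd_iter f c \<phi> \<eta> \<theta>0 ` {1..T}"

subsection \<open>Families of design problems\<close>

text \<open>
  The \<open>n\<close>-th problem has state size \<open>n\<close>; its parameter size is unconstrained and may vary with \<open>n\<close>.
\<close>
definition design_family :: "(nat \<Rightarrow> real vec) \<Rightarrow> (nat \<Rightarrow> phys_system) \<Rightarrow> bool" where
  "design_family c \<phi> \<longleftrightarrow>
     (\<forall>n. c n \<in> carrier_vec n \<and> (\<exists>m. physical_system n m (\<phi> n)))"

definition lipschitz_smooth :: "real \<Rightarrow> (real \<Rightarrow> real) \<Rightarrow> bool" where
  "lipschitz_smooth L f \<longleftrightarrow>
     (\<forall>x. f differentiable at x) \<and> (\<forall>x y. \<bar>deriv f x - deriv f y\<bar> \<le> L * \<bar>x - y\<bar>)"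

definition strongly_convex :: "real \<Rightarrow> (real \<Rightarrow> real) \<Rightarrow> bool" where
  "strongly_convex \<mu> f \<longleftrightarrow>
     (\<forall>x y. f y \<ge> f x + deriv f x * (y - x) + \<mu> / 2 * \<bar>x - y\<bar>\<^sup>2)"

text \<open>
  All quantities below are nonnegative for \<open>n > 0\<close>, so the library's Landau symbols, which
  compare absolute values, agree with one-sided bounds.
\<close>
definition convergence_conditions ::
    "real \<Rightarrow> real \<Rightarrow> (real \<Rightarrow> real) \<Rightarrow> (nat \<Rightarrow> real vec) \<Rightarrow> (nat \<Rightarrow> phys_system) \<Rightarrow> bool" where
  "convergence_conditions \<alpha> \<gamma> f c \<phi> \<longleftrightarrow>
     (\<exists>L \<mu>. lipschitz_smooth L f \<and> \<mu> > 0 \<and> strongly_convex \<mu> f) \<and> bdd_below (range f) \<and>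
     (\<forall>n. invertible_mat (sysA (\<phi> n))) \<and>
     (\<lambda>n. induced_norm vnorm2 (minv (sysA (\<phi> n)))) \<in> O(\<lambda>n. real n powr \<gamma>) \<and>
     (\<lambda>n. induced_norm vnorm_inf (sysB (\<phi> n))) \<in> O(\<lambda>_. 1) \<and>
     (\<lambda>n. induced_norm vnorm1 (sysB (\<phi> n))) \<in> O(\<lambda>_. 1) \<and>
     (\<lambda>n. induced_norm vnorm2 (sysB (\<phi> n))) \<in> O(\<lambda>_. 1) \<and>
     (\<lambda>n. vnorm_inf (sysb (\<phi> n))) \<in> O(\<lambda>_. 1) \<and>
     (\<lambda>n. vnorm1 (sysb (\<phi> n))) \<in> O(\<lambda>_. 1) \<and>
     (\<lambda>n. vnorm_inf (c n)) \<in> O(\<lambda>_. 1) \<and>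
     (\<lambda>n. vnorm1 (c n)) \<in> O(\<lambda>_. 1) \<and>
     (\<lambda>n. (vnorm2 (transpose_mat (sysB (\<phi> n)) *\<^sub>v
              component_mult (minv (sysA (\<phi> n)) *\<^sub>v sysb (\<phi> n))
                (transpose_mat (minv (sysA (\<phi> n))) *\<^sub>v c n)))\<^sup>2)
        \<in> \<Omega>(\<lambda>n. real n powr (\<alpha> + \<gamma>)) \<and>
     (\<lambda>n. \<bar>c n \<bullet> (minv (sysA (\<phi> n)) *\<^sub>v sysb (\<phi> n))\<bar>) \<in> O(\<lambda>_. 1)"

text \<open>\<open>a\<close> is bounded by \<open>O(h n)\<close> for some \<open>h\<close> growing more slowly than every power \<open>n\<^sup>\<delta>\<close>.\<close>
definition subpolynomial :: "(nat \<Rightarrow> real) \<Rightarrow> bool" where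
  "subpolynomial a \<longleftrightarrow> (\<exists>h. (\<forall>\<delta>>0. h \<in> o(\<lambda>n. real n powr \<delta>)) \<and> a \<in> O(h))"

definition non_resonant ::
    "(nat \<Rightarrow> real vec) \<Rightarrow> (nat \<Rightarrow> phys_system) \<Rightarrow> (nat \<Rightarrow> real vec) \<Rightarrow> bool" where
  "non_resonant c \<phi> \<theta> \<longleftrightarrow>
     (\<forall>n. \<theta> n \<in> sys_dom (\<phi> n)) \<and>
     subpolynomial (\<lambda>n. vnorm_inf (sys_state (\<phi> n) (\<theta> n))) \<and>
     subpolynomial (\<lambda>n. vnorm_inf (sys_adjoint (\<phi> n) (\<theta> n) (c n)))"

subsection \<open>The closed form of the gradient\<close>

lemma minv:
  assumes M: "M \<in> carrier_mat n n" and inv: "invertible_mat M"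
  shows "minv M \<in> carrier_mat n n" "M * minv M = 1\<^sub>m n" "minv M * M = 1\<^sub>m n"
proof -
  from inv obtain N where N: "M * N = 1\<^sub>m n" "N * M = 1\<^sub>m (dim_row N)"
    using M unfolding invertible_mat_def inverts_mat_def by auto
  have "dim_col N = n" using arg_cong[OF N(1), of dim_col] by simp
  moreover have "dim_row N = n" using arg_cong[OF N(2), of dim_col] M by simp
  ultimately have Nc: "N \<in> carrier_mat n n" by auto
  have "M \<in> Units (ring_mat TYPE(real) n ())"
    unfolding Units_def ring_mat_def using M N Nc by auto
  with mat_inverse(1)[OF M, where b = "()"] obtain B where B: "mat_inverse M = Some B" by auto
  from mat_inverse(2)[OF M B] B
  show "minv M \<in> carrier_mat n n" "M * minv M = 1\<^sub>m n" "minv M * M = 1\<^sub>m n"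
    unfolding minv_def by auto
qed

lemma invertible_mat_iff_det:
  fixes M :: "real mat"
  assumes M: "M \<in> carrier_mat n n"
  shows "invertible_mat M \<longleftrightarrow> det M \<noteq> 0"
proof
  assume "invertible_mat M"
  from minv[OF M this] det_mult[OF M, of "minv M"] show "det M \<noteq> 0" by auto
next
  assume d: "det M \<noteq> 0"
  let ?N = "(1 / det M) \<cdot>\<^sub>m adj_mat M"
  note a = adj_mat[OF M]
  have "M * ?N = (1 / det M) \<cdot>\<^sub>m (M * adj_mat M)"
    by (rule mult_smult_distrib[OF M a(1)])
  also have "\<dots> = 1\<^sub>m n" unfolding a(2) using d by (intro eq_matI) auto
  finally have 1: "M * ?N = 1\<^sub>m n" .
  have "?N * M = (1 / det M) \<cdot>\<^sub>m (adj_mat M * M)"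
    by (rule mult_smult_assoc_mat[OF a(1) M])
  also have "\<dots> = 1\<^sub>m n" unfolding a(3) using d by (intro eq_matI) auto
  finally have 2: "?N * M = 1\<^sub>m n" .
  show "invertible_mat M" unfolding invertible_mat_def inverts_mat_def
    using 1 2 M a(1) by (auto intro!: exI[of _ ?N])
qed

lemma minv_eq_adj:
  assumes M: "M \<in> carrier_mat n n" and d: "det M \<noteq> 0"
  shows "minv M = (1 / det M) \<cdot>\<^sub>m adj_mat M"
proof -
  note a = adj_mat[OF M]
  have "invertible_mat M" using d invertible_mat_iff_det[OF M] by simp
  note m = minv[OF M this]
  have "det M \<cdot>\<^sub>m minv M = (det M \<cdot>\<^sub>m 1\<^sub>m n) * minv M"
    using mult_smult_assoc_mat[of "1\<^sub>m n" n n "minv M" n "det M"] m(1) by simp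
  also have "\<dots> = adj_mat M * (M * minv M)"
    unfolding a(3)[symmetric] using a(1) M m(1) by (rule assoc_mult_mat)
  also have "\<dots> = adj_mat M" using m(2) a(1) by simp
  finally have e: "det M \<cdot>\<^sub>m minv M = adj_mat M" .
  show ?thesis unfolding e[symmetric] using d by (intro eq_matI) auto
qed

lemma isCont_det:
  fixes F :: "real \<Rightarrow> real mat"
  assumes F: "\<And>t. F t \<in> carrier_mat n n"
    and cont: "\<And>i j. i < n \<Longrightarrow> j < n \<Longrightarrow> isCont (\<lambda>t. F t $$ (i, j)) a"
  shows "isCont (\<lambda>t. det (F t)) a"
proof -
  have "(\<lambda>t. det (F t)) =
      (\<lambda>t. \<Sum>p\<in>{p. p permutes {0..<n}}. signof p * (\<Prod>i = 0..<n. F t $$ (i, p i)))"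
    using det_def'[OF F] by auto
  moreover have "isCont \<dots> a"
  proof (intro continuous_sum continuous_mult continuous_const continuous_prod cont)
    fix p i assume p: "p \<in> {p. p permutes {0..<n}}" and i: "i \<in> {0..<n}"
    then show "i < n" "p i < n" using permutes_in_image[of p "{0..<n}" i] by auto
  qed
  ultimately show ?thesis by simp
qed

lemma isCont_adj_mat:
  fixes F :: "real \<Rightarrow> real mat"
  assumes F: "\<And>t. F t \<in> carrier_mat n n"
    and cont: "\<And>i j. i < n \<Longrightarrow> j < n \<Longrightarrow> isCont (\<lambda>t. F t $$ (i, j)) a"
    and ij: "i < n" "j < n"
  shows "isCont (\<lambda>t. adj_mat (F t) $$ (i, j)) a"
proof -
  have d: "dim_row (F t) = n" "dim_col (F t) = n" for t using F[of t] by auto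
  have "(\<lambda>t. adj_mat (F t) $$ (i, j)) = (\<lambda>t. (-1) ^ (j + i) * det (mat_delete (F t) j i))"
    using ij d by (auto simp: adj_mat_def cofactor_def)
  moreover have "isCont (\<lambda>t. det (mat_delete (F t) j i)) a"
  proof (rule isCont_det)
    show "mat_delete (F t) j i \<in> carrier_mat (n - 1) (n - 1)" for t
      using d by (simp add: mat_delete_def)
    fix k l assume kl: "k < n - 1" "l < n - 1"
    then have "(\<lambda>t. mat_delete (F t) j i $$ (k, l)) =
        (\<lambda>t. F t $$ (if k < j then k else Suc k, if l < i then l else Suc l))"
      using d by (auto simp: mat_delete_def)
    then show "isCont (\<lambda>t. mat_delete (F t) j i $$ (k, l)) a"
      using cont kl by simp
  qed
  ultimately show ?thesis by simp
qed

lemma objective_directional_derivative: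
  assumes sys: "physical_system n m \<phi>" and c: "c \<in> carrier_vec n"
    and \<theta>: "\<theta> \<in> sys_dom \<phi>" and d: "d \<in> carrier_vec m"
    and f: "f differentiable at (c \<bullet> sys_state \<phi> \<theta>)"
  shows "((\<lambda>t. objective f c \<phi> (\<theta> + t \<cdot>\<^sub>v d)) has_real_derivative
           objective_grad f c \<phi> \<theta> \<bullet> d) (at 0)"
proof -
  from sys have A: "sysA \<phi> \<in> carrier_mat n n" and B: "sysB \<phi> \<in> carrier_mat n m"
    and b: "sysb \<phi> \<in> carrier_vec n" by (auto simp: physical_system_def)
  from \<theta> B have \<theta>c: "\<theta> \<in> carrier_vec m" and inv: "invertible_mat (sys_mat \<phi> \<theta>)"
    by (auto simp: sys_dom_def)
  define M where "M = (\<lambda>t. sys_mat \<phi> (\<theta> + t \<cdot>\<^sub>v d))"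
  define x where "x = (\<lambda>t. sys_state \<phi> (\<theta> + t \<cdot>\<^sub>v d))"
  define y where "y = sys_adjoint \<phi> \<theta> c"
  define w where "w = sysB \<phi> *\<^sub>v d"
  have \<theta>0: "\<theta> + 0 \<cdot>\<^sub>v d = \<theta>" using \<theta>c d by (intro eq_vecI) auto
  have Mc: "M t \<in> carrier_mat n n" for t
    using A B by (simp add: M_def sys_mat_def mat_diag_def)
  have wc: "w \<in> carrier_vec n" using B by (simp add: w_def mult_mat_vec_def)
  have Bt: "sysB \<phi> *\<^sub>v (\<theta> + t \<cdot>\<^sub>v d) = sysB \<phi> *\<^sub>v \<theta> + t \<cdot>\<^sub>v w" for t
    unfolding w_def using mult_add_distrib_mat_vec[OF B \<theta>c, of "t \<cdot>\<^sub>v d"] mult_mat_vec[OF B d] d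
    by simp
  have Me: "M t $$ (i, j) = M 0 $$ (i, j) + (if i = j then t * w $ j else 0)"
    if "i < n" "j < n" for t i j
    using that A B wc by (auto simp: M_def sys_mat_def mat_diag_def Bt)
  have cont: "isCont (\<lambda>t. M t $$ (i, j)) 0" if "i < n" "j < n" for i j
  proof -
    have "isCont (\<lambda>t. M 0 $$ (i, j) + (if i = j then t * w $ j else 0)) 0"
      by (cases "i = j") (auto intro!: continuous_intros)
    moreover have "(\<lambda>t. M t $$ (i, j)) = (\<lambda>t. M 0 $$ (i, j) + (if i = j then t * w $ j else 0))"
      by (rule ext) (rule Me[OF that])
    ultimately show ?thesis by simp
  qed
  have det0: "det (M 0) \<noteq> 0"
    using inv invertible_mat_iff_det[OF Mc[of 0]] by (simp add: M_def \<theta>0)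
  have "isCont (\<lambda>t. det (M t)) 0" by (rule isCont_det[OF Mc cont])
  then have "(\<lambda>t. det (M t)) \<midarrow>0\<rightarrow> det (M 0)" by (simp add: isCont_def)
  then have ev: "eventually (\<lambda>t. det (M t) \<noteq> 0) (at 0)"
    using det0 tendsto_imp_eventually_ne by blast
  have xe: "x t $ i = (\<Sum>k<n. adj_mat (M t) $$ (i, k) * sysb \<phi> $ k) / det (M t)"
    if "det (M t) \<noteq> 0" "i < n" for t i
  proof -
    have "x t = ((1 / det (M t)) \<cdot>\<^sub>m adj_mat (M t)) *\<^sub>v sysb \<phi>"
      using minv_eq_adj[OF Mc that(1)] by (simp add: x_def sys_state_def M_def)
    then show ?thesis using that adj_mat(1)[OF Mc[of t]] b
      by (auto simp: scalar_prod_def sum_divide_distrib lessThan_atLeast0 intro!: sum.cong)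
  qed
  have xlim: "(\<lambda>t. x t $ i) \<midarrow>0\<rightarrow> x 0 $ i" if i: "i < n" for i
  proof -
    have "isCont (\<lambda>t. (\<Sum>k<n. adj_mat (M t) $$ (i, k) * sysb \<phi> $ k) / det (M t)) 0"
      using det0 i
      by (intro continuous_divide continuous_sum continuous_mult continuous_const
          isCont_adj_mat[OF Mc cont] isCont_det[OF Mc cont]) auto
    then have "(\<lambda>t. (\<Sum>k<n. adj_mat (M t) $$ (i, k) * sysb \<phi> $ k) / det (M t)) \<midarrow>0\<rightarrow> x 0 $ i"
      unfolding isCont_def xe[OF det0 i] .
    then show ?thesis
      by (rule Lim_transform_eventually) (use ev in eventually_elim, simp add: xe i)
  qed
  have xb: "M t *\<^sub>v x t = sysb \<phi>" "x t \<in> carrier_vec n" if "det (M t) \<noteq> 0" for t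
  proof -
    have "invertible_mat (M t)" using that invertible_mat_iff_det[OF Mc] by simp
    note mi = minv[OF Mc this]
    have xt: "x t = minv (M t) *\<^sub>v sysb \<phi>" by (simp add: x_def M_def sys_state_def)
    show "x t \<in> carrier_vec n" unfolding xt using mi(1) b by simp
    have "M t *\<^sub>v x t = (M t * minv (M t)) *\<^sub>v sysb \<phi>"
      unfolding xt using assoc_mult_mat_vec[OF Mc mi(1) b] by simp
    then show "M t *\<^sub>v x t = sysb \<phi>" using mi(2) b by simp
  qed
  note mi0 = minv[OF Mc[of 0, unfolded M_def \<theta>0] inv]
  have yc: "y \<in> carrier_vec n" unfolding y_def sys_adjoint_def using mi0(1) c by auto
  have yx: "y \<bullet> (M 0 *\<^sub>v v) = c \<bullet> v" if v: "v \<in> carrier_vec n" for v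
  proof -
    have M0: "M 0 = sys_mat \<phi> \<theta>" by (simp add: M_def \<theta>0)
    have "y \<bullet> (M 0 *\<^sub>v v) = c \<bullet> (minv (M 0) *\<^sub>v (M 0 *\<^sub>v v))"
      unfolding y_def sys_adjoint_def M0
      using transpose_vec_mult_scalar[OF mi0(1) _ c, of "sys_mat \<phi> \<theta> *\<^sub>v v"] Mc[of 0] v
      by (simp add: M0)
    also have "minv (M 0) *\<^sub>v (M 0 *\<^sub>v v) = (minv (M 0) * M 0) *\<^sub>v v"
      using assoc_mult_mat_vec[OF _ Mc[of 0] v, of "minv (M 0)" n] mi0(1) by (simp add: M0)
    finally show ?thesis using mi0(3) v by (simp add: M0)
  qed
  have quot: "(c \<bullet> x t - c \<bullet> x 0) / t = - (\<Sum>i<n. y $ i * (w $ i * x t $ i))"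
    if t: "t \<noteq> 0" and dt: "det (M t) \<noteq> 0" for t
  proof -
    note x0 = xb[OF det0] and xt = xb[OF dt]
    have row: "(M t *\<^sub>v x t) $ i = (M 0 *\<^sub>v x t) $ i + t * (w $ i * x t $ i)" if i: "i < n" for i
    proof -
      have "(M t *\<^sub>v x t) $ i = (\<Sum>j<n. M t $$ (i, j) * x t $ j)"
        using i Mc[of t] xt(2) by (auto simp: scalar_prod_def lessThan_atLeast0 intro!: sum.cong)
      also have "\<dots> = (\<Sum>j<n. M 0 $$ (i, j) * x t $ j + (if i = j then t * w $ j * x t $ j else 0))"
        using i by (intro sum.cong refl) (subst Me, auto simp: algebra_simps)
      also have "\<dots> = (\<Sum>j<n. M 0 $$ (i, j) * x t $ j) + t * w $ i * x t $ i"
        using i by (simp add: sum.distrib)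
      also have "(\<Sum>j<n. M 0 $$ (i, j) * x t $ j) = (M 0 *\<^sub>v x t) $ i"
        using i Mc[of 0] xt(2) by (auto simp: scalar_prod_def lessThan_atLeast0 intro!: sum.cong)
      finally show ?thesis by simp
    qed
    have "c \<bullet> x t = y \<bullet> (M 0 *\<^sub>v x t)" using yx[OF xt(2)] by simp
    also have "\<dots> = (\<Sum>i<n. y $ i * (M 0 *\<^sub>v x t) $ i)"
      using Mc[of 0] by (auto simp: scalar_prod_def lessThan_atLeast0 intro!: sum.cong)
    also have "\<dots> = (\<Sum>i<n. y $ i * sysb \<phi> $ i - t * (y $ i * (w $ i * x t $ i)))"
    proof (intro sum.cong refl)
      fix i assume "i \<in> {..<n}"
      then have "(M 0 *\<^sub>v x t) $ i = sysb \<phi> $ i - t * (w $ i * x t $ i)"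
        using row[of i] xt(1) by simp
      then show "y $ i * (M 0 *\<^sub>v x t) $ i = y $ i * sysb \<phi> $ i - t * (y $ i * (w $ i * x t $ i))"
        by (simp only: right_diff_distrib mult.left_commute)
    qed
    also have "\<dots> = (\<Sum>i<n. y $ i * sysb \<phi> $ i) - t * (\<Sum>i<n. y $ i * (w $ i * x t $ i))"
      by (simp add: sum_subtractf sum_distrib_left)
    also have "(\<Sum>i<n. y $ i * sysb \<phi> $ i) = y \<bullet> sysb \<phi>"
      using b by (auto simp: scalar_prod_def lessThan_atLeast0 intro!: sum.cong)
    also have "y \<bullet> sysb \<phi> = c \<bullet> x 0" using yx[OF x0(2)] x0(1) by simp
    finally show ?thesis using t by (simp add: field_simps)
  qed
  define g where "g = transpose_mat (sysB \<phi>) *\<^sub>v component_mult (x 0) y"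
  have gd: "g \<bullet> d = (\<Sum>i<n. y $ i * (w $ i * x 0 $ i))"
  proof -
    have cc: "component_mult (x 0) y \<in> carrier_vec n"
      using xb(2)[OF det0] yc by (auto simp: component_mult_def)
    have "g \<bullet> d = component_mult (x 0) y \<bullet> w"
      unfolding g_def w_def using transpose_vec_mult_scalar[OF B d cc] .
    then show ?thesis using xb(2)[OF det0] yc wc
      by (auto simp: scalar_prod_def component_mult_def lessThan_atLeast0 intro!: sum.cong)
  qed
  have "(\<lambda>t. - (\<Sum>i<n. y $ i * (w $ i * x t $ i))) \<midarrow>0\<rightarrow> - (g \<bullet> d)"
    unfolding gd by (intro tendsto_intros xlim) auto
  moreover have "eventually (\<lambda>t. - (\<Sum>i<n. y $ i * (w $ i * x t $ i)) = (c \<bullet> x t - c \<bullet> x 0) / t) (at 0)"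
    using ev eventually_neq_at_within[of 0 0] by eventually_elim (simp add: quot)
  ultimately have "(\<lambda>t. (c \<bullet> x t - c \<bullet> x 0) / t) \<midarrow>0\<rightarrow> - (g \<bullet> d)"
    by (rule Lim_transform_eventually)
  then have dx: "((\<lambda>t. c \<bullet> x t) has_real_derivative - (g \<bullet> d)) (at 0)"
    by (simp add: DERIV_def)
  have "(f has_real_derivative deriv f (c \<bullet> x 0)) (at (c \<bullet> x 0))"
    using f by (auto simp: x_def \<theta>0 real_differentiable_def DERIV_imp_deriv)
  from DERIV_chain2[OF this dx]
  have "((\<lambda>t. f (c \<bullet> x t)) has_real_derivative deriv f (c \<bullet> x 0) * - (g \<bullet> d)) (at 0)" .
  moreover have "deriv f (c \<bullet> x 0) * - (g \<bullet> d) = objective_grad f c \<phi> \<theta> \<bullet> d"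
  proof -
    have "g \<in> carrier_vec m" unfolding g_def using B by (simp add: mult_mat_vec_def)
    then show ?thesis using d
      by (simp add: objective_grad_def g_def[symmetric] x_def \<theta>0 y_def[symmetric]
          flip: g_def[unfolded x_def \<theta>0])
  qed
  ultimately show ?thesis by (simp add: objective_def x_def)
qed

end

theory Submission
  imports Defs
begin

text \<open>
  Along a run, write \<open>x\<close> for the state, \<open>y\<close> for the adjoint, \<open>w = B \<theta>\<close> for the perturbation of the
  diagonal, \<open>u\<close> for the observable \<open>c \<bullet> x\<close>, and \<open>g\<close> for the vector obtained by applying the
  transpose of \<open>B\<close> to the componentwise product of \<open>x\<close> and \<open>y\<close>. The gradient of \<open>u\<close> is \<open>- g\<close>, so a
  step changes \<open>u\<close> to first order by \<open>- \<eta> * f' u * (norm g)\<^sup>2\<close>: the observable itself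
  performs gradient descent on the function \<open>f\<close> of one variable, with step length
  \<open>\<eta> * (norm g)\<^sup>2\<close>. For a smooth strongly convex \<open>f\<close> this shrinks the gap to the minimum by the
  factor \<open>exp (- \<mu> * \<eta> * (norm g)\<^sup>2 / 2)\<close> per step. If the norm of \<open>g\<close> never falls below half of
  its initial value, at least of order \<open>n powr ((\<alpha> + \<gamma>) / 2)\<close>, then the exponent per step is at least of order
  \<open>n powr (- (1 - 2 * (\<alpha> - \<gamma>)))\<close>, and a constant multiple of
  \<open>n powr (1 - 2 * (\<alpha> - \<gamma>)) * ln (1 / \<epsilon>)\<close> steps reach the accuracy \<open>\<epsilon>\<close>
  (\<open>exp_decay_le\<close>).

  It remains to see that \<open>g\<close> hardly moves. Up to subpolynomial factors, non-resonance bounds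
  every step of \<open>\<theta>\<close> by \<open>\<eta>\<close> in the maximum norm and, with the inverse of \<open>A\<close>, by
  \<open>\<eta> * n powr \<gamma>\<close> in the Euclidean norm. Over the run this adds up to \<open>n powr (- \<alpha> - \<gamma>)\<close> and
  \<open>n powr (- \<alpha>)\<close>. The first is small against \<open>n powr (- \<gamma>)\<close>, so the diagonal perturbation never
  comes near to making the matrix singular; by the second and \<open>perturbed_solution_diff_le\<close>, the
  vectors \<open>x\<close> and \<open>y\<close>, and hence \<open>g\<close>, move by at most \<open>n powr (\<gamma> - \<alpha>)\<close>. This is small against
  \<open>n powr ((\<alpha> + \<gamma>) / 2)\<close> exactly because \<open>\<gamma> < 3 * \<alpha>\<close>. Since the length of a step depends on the
  derivative of \<open>f\<close>, which is controlled through the gap, the estimates are proved together by one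
  induction (\<open>gap_contracts\<close>).

  Two points need care. The bounds of non-resonance start with the first generated design;
  \<open>start_not_resonant\<close> transfers them to the starting point. And the second-order effects are
  small once \<open>\<alpha> - \<gamma> < 1\<close> and \<open>\<alpha> - 2 * \<gamma> < 1\<close>. As the number of steps is at least \<open>1\<close> and of
  order \<open>n powr (1 - 2 * (\<alpha> - \<gamma>))\<close>, one has \<open>\<alpha> - \<gamma> \<le> 1 / 2\<close>; with \<open>\<alpha> > 1 / 4\<close> this gives
  \<open>\<gamma> > - 1 / 4\<close> and both inequalities.
\<close>

section \<open>Smooth strongly convex functions of one variable\<close>

lemma strongly_convex_lower_bound:
  assumes "strongly_convex \<mu> f" and "\<mu> > 0"
  shows "f x - (deriv f x)\<^sup>2 / (2 * \<mu>) \<le> f y"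
proof -
  have "f x + deriv f x * (y - x) + \<mu> / 2 * \<bar>x - y\<bar>\<^sup>2 \<le> f y"
    using assms(1) unfolding strongly_convex_def by blast
  moreover have "0 \<le> (\<mu> * (y - x) + deriv f x)\<^sup>2 / (2 * \<mu>)" using assms(2) by simp
  moreover have "(\<mu> * (y - x) + deriv f x)\<^sup>2 / (2 * \<mu>)
      = deriv f x * (y - x) + \<mu> / 2 * \<bar>x - y\<bar>\<^sup>2 + (deriv f x)\<^sup>2 / (2 * \<mu>)"
    using assms(2) by (simp add: field_simps power2_eq_square)
  ultimately show ?thesis by linarith
qed

text \<open>Strong convexity turns a large gap into a large derivative; this is what makes the gap
  contract geometrically instead of merely decrease.\<close>
lemma polyak_lojasiewicz:
  assumes "strongly_convex \<mu> f" and "\<mu> > 0"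
  shows "2 * \<mu> * (f x - (INF x. f x)) \<le> (deriv f x)\<^sup>2"
proof -
  have "f x - (deriv f x)\<^sup>2 / (2 * \<mu>) \<le> (INF x. f x)"
    by (rule cINF_greatest) (auto intro: strongly_convex_lower_bound[OF assms])
  then have "f x - (INF x. f x) \<le> (deriv f x)\<^sup>2 / (2 * \<mu>)" by simp
  with assms(2) show ?thesis by (simp add: field_simps)
qed

text \<open>The convexity inequality at \<open>y\<close> bounds \<open>f y\<close> from above by the derivative at \<open>y\<close>, which
  the Lipschitz condition moves to \<open>x\<close>. Integrating the derivative instead would give the
  sharper constant \<open>L / 2\<close>.\<close>
lemma smooth_upper_bound:
  assumes "strongly_convex \<mu> f" and "\<mu> > 0" and "lipschitz_smooth L f"
  shows "f y \<le> f x + deriv f x * (y - x) + L * (y - x)\<^sup>2"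
proof -
  have "f y + deriv f y * (x - y) + \<mu> / 2 * \<bar>y - x\<bar>\<^sup>2 \<le> f x"
    using assms(1) unfolding strongly_convex_def by blast
  moreover have "0 \<le> \<mu> / 2 * \<bar>y - x\<bar>\<^sup>2" using assms(2) by simp
  moreover have "(deriv f y - deriv f x) * (y - x) \<le> L * (y - x)\<^sup>2"
  proof -
    have "(deriv f y - deriv f x) * (y - x) \<le> \<bar>deriv f y - deriv f x\<bar> * \<bar>y - x\<bar>"
      by (metis abs_ge_self abs_mult)
    also have "\<dots> \<le> L * \<bar>y - x\<bar> * \<bar>y - x\<bar>"
      using assms(3) unfolding lipschitz_smooth_def by (intro mult_right_mono) auto
    finally show ?thesis by (simp add: power2_eq_square mult.assoc)
  qed
  ultimately show ?thesis by (simp add: algebra_simps)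
qed

text \<open>A gradient step of length \<open>1 / (2 * L)\<close> cannot undershoot the minimum.\<close>
lemma deriv_square_le_gap:
  assumes "strongly_convex \<mu> f" and "\<mu> > 0" and "lipschitz_smooth L f" and "L > 0"
    and "bdd_below (range f)"
  shows "(deriv f x)\<^sup>2 \<le> 4 * L * (f x - (INF x. f x))"
proof -
  let ?y = "x - deriv f x / (2 * L)"
  have "(INF x. f x) \<le> f ?y" by (rule cINF_lower) (use assms(5) in auto)
  also have "\<dots> \<le> f x + deriv f x * (?y - x) + L * (?y - x)\<^sup>2"
    by (rule smooth_upper_bound[OF assms(1-3)])
  also have "\<dots> = f x - (deriv f x)\<^sup>2 / (4 * L)"
    using assms(4) by (simp add: field_simps power2_eq_square)
  finally show ?thesis using assms(4) by (simp add: field_simps)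
qed

lemma gradient_step_contracts:
  assumes "strongly_convex \<mu> f" and "\<mu> > 0" and "lipschitz_smooth L f"
    and "0 \<le> s" and "2 * L * s \<le> 1"
  shows "f (x - s * deriv f x) - (INF x. f x) \<le> (1 - \<mu> * s) * (f x - (INF x. f x))"
proof -
  have "f (x - s * deriv f x) \<le> f x - s * (deriv f x)\<^sup>2 + L * s\<^sup>2 * (deriv f x)\<^sup>2"
    using smooth_upper_bound[OF assms(1-3), of "x - s * deriv f x" x]
    by (simp add: power2_eq_square algebra_simps)
  also have "L * s\<^sup>2 * (deriv f x)\<^sup>2 \<le> s / 2 * (deriv f x)\<^sup>2"
    using mult_right_mono[OF assms(5), of "s / 2"] assms(4)
    by (intro mult_right_mono) (auto simp: power2_eq_square)
  finally have "f (x - s * deriv f x) \<le> f x - s / 2 * (deriv f x)\<^sup>2" by simp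
  also have "\<dots> \<le> f x - s / 2 * (2 * \<mu> * (f x - (INF x. f x)))"
    using polyak_lojasiewicz[OF assms(1,2), of x] assms(4)
    by (intro diff_left_mono mult_left_mono) auto
  finally show ?thesis by (simp add: algebra_simps)
qed

section \<open>Vector norms and induced norms\<close>

lemma vnorm2_nonneg [simp]: "0 \<le> vnorm2 v"
  by (simp add: vnorm2_def)

lemma vnorm1_nonneg [simp]: "0 \<le> vnorm1 v"
  by (simp add: vnorm1_def sum_nonneg)

lemma vnorm_inf_nonneg [simp]: "0 \<le> vnorm_inf v"
  by (simp add: vnorm_inf_def)

lemma index_le_vnorm_inf: "i < dim_vec v \<Longrightarrow> \<bar>v $ i\<bar> \<le> vnorm_inf v"
  by (simp add: vnorm_inf_def)

lemma vnorm_inf_le_iff: "vnorm_inf v \<le> r \<longleftrightarrow> 0 \<le> r \<and> (\<forall>i<dim_vec v. \<bar>v $ i\<bar> \<le> r)"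
  by (auto simp: vnorm_inf_def)

lemma vnorm2_square: "(vnorm2 v)\<^sup>2 = v \<bullet> v"
  by (simp add: vnorm2_def L2_set_def sum_nonneg scalar_prod_def lessThan_atLeast0
      power2_eq_square)

lemma abs_scalar_prod_le_vnorm2:
  assumes "dim_vec v = dim_vec w"
  shows "\<bar>v \<bullet> w\<bar> \<le> vnorm2 v * vnorm2 w"
proof -
  have "\<bar>v \<bullet> w\<bar> \<le> (\<Sum>i<dim_vec w. \<bar>v $ i\<bar> * \<bar>w $ i\<bar>)"
    unfolding scalar_prod_def lessThan_atLeast0 abs_mult[symmetric] by (rule sum_abs)
  also have "\<dots> \<le> vnorm2 v * vnorm2 w"
    unfolding vnorm2_def assms by (rule L2_set_mult_ineq)
  finally show ?thesis .
qed

lemma vnorm2_add_le: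
  assumes "dim_vec v = dim_vec w"
  shows "vnorm2 (v + w) \<le> vnorm2 v + vnorm2 w"
proof -
  have "vnorm2 (v + w) = L2_set (\<lambda>i. v $ i + w $ i) {..<dim_vec w}"
    unfolding vnorm2_def by (intro L2_set_cong) auto
  also have "\<dots> \<le> vnorm2 v + vnorm2 w"
    unfolding vnorm2_def assms by (rule L2_set_triangle_ineq)
  finally show ?thesis .
qed

lemma vnorm2_smult [simp]: "vnorm2 (r \<cdot>\<^sub>v v) = \<bar>r\<bar> * vnorm2 v"
proof -
  have "(vnorm2 (r \<cdot>\<^sub>v v))\<^sup>2 = (\<bar>r\<bar> * vnorm2 v)\<^sup>2"
    by (simp add: vnorm2_square power_mult_distrib) (simp add: power2_eq_square)
  then show ?thesis by (simp add: power2_eq_iff_nonneg)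
qed

lemma vnorm2_minus_commute:
  assumes "dim_vec v = dim_vec w"
  shows "vnorm2 (v - w) = vnorm2 (w - v)"
proof -
  have "v - w = (-1) \<cdot>\<^sub>v (w - v)" using assms by (intro eq_vecI) auto
  then show ?thesis by simp
qed

lemma vnorm_inf_add_le:
  assumes "dim_vec v = dim_vec w"
  shows "vnorm_inf (v + w) \<le> vnorm_inf v + vnorm_inf w"
  unfolding vnorm_inf_le_iff
  using assms by (auto intro!: add_mono order.trans[OF abs_triangle_ineq] index_le_vnorm_inf)

lemma vnorm_inf_smult_le: "vnorm_inf (r \<cdot>\<^sub>v v) \<le> \<bar>r\<bar> * vnorm_inf v"
  unfolding vnorm_inf_le_iff by (auto simp: abs_mult intro!: mult_left_mono index_le_vnorm_inf)

lemma vnorm_inf_le_vnorm2: "vnorm_inf v \<le> vnorm2 v"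
  unfolding vnorm_inf_le_iff
proof (intro conjI allI impI)
  fix i assume "i < dim_vec v"
  then have "(v $ i)\<^sup>2 \<le> (\<Sum>i<dim_vec v. (v $ i)\<^sup>2)"
    by (intro member_le_sum) auto
  then show "\<bar>v $ i\<bar> \<le> vnorm2 v"
    unfolding vnorm2_def L2_set_def by (metis real_sqrt_abs real_sqrt_le_mono)
qed simp

lemma vnorm2_le_vnorm1: "vnorm2 v \<le> vnorm1 v"
  unfolding vnorm2_def vnorm1_def by (rule L2_set_le_sum_abs)

lemma vnorm1_le_dim_vnorm_inf: "vnorm1 v \<le> dim_vec v * vnorm_inf v"
  unfolding vnorm1_def using sum_bounded_above[of "{..<dim_vec v}" "\<lambda>i. \<bar>v $ i\<bar>" "vnorm_inf v"]
  by (auto intro: index_le_vnorm_inf)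

lemma abs_scalar_prod_le_vnorm1_vnorm_inf:
  assumes "dim_vec v = dim_vec w"
  shows "\<bar>v \<bullet> w\<bar> \<le> vnorm1 v * vnorm_inf w"
proof -
  have "\<bar>v \<bullet> w\<bar> \<le> (\<Sum>i<dim_vec w. \<bar>v $ i\<bar> * \<bar>w $ i\<bar>)"
    unfolding scalar_prod_def lessThan_atLeast0 abs_mult[symmetric] by (rule sum_abs)
  also have "\<dots> \<le> (\<Sum>i<dim_vec w. \<bar>v $ i\<bar> * vnorm_inf w)"
    by (intro sum_mono mult_left_mono index_le_vnorm_inf) auto
  finally show ?thesis by (simp add: vnorm1_def assms sum_distrib_right)
qed

lemma component_mult_carrier [simp]:
  "v \<in> carrier_vec n \<Longrightarrow> w \<in> carrier_vec n \<Longrightarrow> component_mult v w \<in> carrier_vec n"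
  by (simp add: component_mult_def)

lemma component_mult_commute: "component_mult v w = component_mult w (v :: real vec)"
  by (intro eq_vecI) (auto simp: component_mult_def)

lemma vnorm2_component_mult_le:
  assumes "v \<in> carrier_vec n" "w \<in> carrier_vec n"
  shows "vnorm2 (component_mult v w) \<le> vnorm_inf v * vnorm2 w"
proof -
  have "(vnorm2 (component_mult v w))\<^sup>2 \<le> (vnorm_inf v * vnorm2 w)\<^sup>2"
    unfolding power_mult_distrib vnorm2_def L2_set_def using assms
    by (auto simp: sum_nonneg component_mult_def sum_distrib_left power_mult_distrib
        intro!: sum_mono mult_right_mono
          power_mono[OF index_le_vnorm_inf, where n = 2, unfolded power2_abs])
  then show ?thesis by (rule power2_le_imp_le) simp
qed

lemma vnorm_inf_component_mult_le:
  assumes "v \<in> carrier_vec n" "w \<in> carrier_vec n"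
  shows "vnorm_inf (component_mult v w) \<le> vnorm_inf v * vnorm_inf w"
  unfolding vnorm_inf_le_iff using assms
  by (auto simp: component_mult_def abs_mult intro!: mult_mono index_le_vnorm_inf)

lemma vnorm2_diff_le:
  assumes "dim_vec v = dim_vec w"
  shows "vnorm2 v \<le> vnorm2 w + vnorm2 (v - w)"
proof -
  have "v = w + (v - w)" using assms by (intro eq_vecI) auto
  then show ?thesis using vnorm2_add_le[of w "v - w"] assms by simp
qed

lemma vnorm_inf_diff_le:
  assumes "dim_vec v = dim_vec w"
  shows "vnorm_inf v \<le> vnorm_inf w + vnorm_inf (v - w)"
proof -
  have "v = w + (v - w)" using assms by (intro eq_vecI) auto
  then show ?thesis using vnorm_inf_add_le[of w "v - w"] assms by simp
qed

text \<open>A supremum of reals bounds its members only if it is finite. Here it is, since a norm between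
  \<^const>\<open>vnorm_inf\<close> and \<^const>\<open>vnorm1\<close> is equivalent to both on vectors of a fixed dimension. The
  same comparison settles vectors of norm \<open>0\<close>, about which the quotient \<open>0 / 0\<close> says nothing.\<close>
lemma induced_norm_bound:
  fixes N :: "real vec \<Rightarrow> real"
  assumes N: "\<And>x. vnorm_inf x \<le> N x" "\<And>x. N x \<le> vnorm1 x"
    and M: "M \<in> carrier_mat n m" and x: "x \<in> carrier_vec m"
  shows "N (M *\<^sub>v x) \<le> induced_norm N M * N x"
proof -
  define S where "S = (\<Sum>i<n. vnorm1 (row M i))"
  have S0: "0 \<le> S" by (simp add: S_def sum_nonneg)
  have bound: "N (M *\<^sub>v z) \<le> n * S * N z" if z: "z \<in> carrier_vec m" for z
  proof -
    have "vnorm_inf (M *\<^sub>v z) \<le> S * vnorm_inf z"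
      unfolding vnorm_inf_le_iff
    proof (intro conjI allI impI)
      fix i assume "i < dim_vec (M *\<^sub>v z)"
      then have i: "i < n" using M by simp
      have "\<bar>(M *\<^sub>v z) $ i\<bar> \<le> vnorm1 (row M i) * vnorm_inf z"
        using abs_scalar_prod_le_vnorm1_vnorm_inf[of "row M i" z] i M z by simp
      also have "\<dots> \<le> S * vnorm_inf z"
        unfolding S_def using i by (intro mult_right_mono member_le_sum) auto
      finally show "\<bar>(M *\<^sub>v z) $ i\<bar> \<le> S * vnorm_inf z" .
    qed (use S0 in simp)
    then have "n * vnorm_inf (M *\<^sub>v z) \<le> n * (S * N z)"
      using N(1)[of z] S0 by (intro mult_left_mono) (auto intro: order.trans mult_left_mono)
    moreover have "N (M *\<^sub>v z) \<le> n * vnorm_inf (M *\<^sub>v z)"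
      using N(2)[of "M *\<^sub>v z"] vnorm1_le_dim_vnorm_inf[of "M *\<^sub>v z"] M by simp
    ultimately show ?thesis by (simp add: mult.assoc)
  qed
  have Nnn: "0 \<le> N z" for z using N(1)[of z] vnorm_inf_nonneg[of z] by linarith
  have "bdd_above ((\<lambda>x. N (M *\<^sub>v x) / N x) ` carrier_vec (dim_col M))"
  proof (rule bdd_aboveI2)
    fix z :: "real vec" assume "z \<in> carrier_vec (dim_col M)"
    then have "N (M *\<^sub>v z) \<le> n * S * N z" using bound M by auto
    then show "N (M *\<^sub>v z) / N z \<le> n * S"
      using Nnn[of z] S0 by (cases "N z = 0") (auto simp: divide_le_eq)
  qed
  then have "N (M *\<^sub>v x) / N x \<le> induced_norm N M"
    unfolding induced_norm_def using x M by (intro cSUP_upper) auto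
  moreover have "N (M *\<^sub>v x) \<le> 0" if "N x = 0" using bound[OF x] that by simp
  ultimately show ?thesis using Nnn[of x] by (cases "N x = 0") (auto simp: divide_le_eq)
qed

lemma vnorm_inf_le_vnorm1: "vnorm_inf v \<le> vnorm1 v"
  using vnorm_inf_le_vnorm2 vnorm2_le_vnorm1 by (rule order.trans)

lemma vnorm2_transpose_mult_le:
  assumes M: "M \<in> carrier_mat n m" and v: "v \<in> carrier_vec n" and "0 \<le> \<beta>"
    and \<beta>: "\<And>z. z \<in> carrier_vec m \<Longrightarrow> vnorm2 (M *\<^sub>v z) \<le> \<beta> * vnorm2 z"
  shows "vnorm2 (transpose_mat M *\<^sub>v v) \<le> \<beta> * vnorm2 v"
proof -
  let ?w = "transpose_mat M *\<^sub>v v"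
  have w: "?w \<in> carrier_vec m" using M v by simp
  have "(vnorm2 ?w)\<^sup>2 = v \<bullet> (M *\<^sub>v ?w)"
    unfolding vnorm2_square using transpose_vec_mult_scalar[OF M w v] .
  also have "\<dots> \<le> vnorm2 v * vnorm2 (M *\<^sub>v ?w)"
    using abs_scalar_prod_le_vnorm2[of v "M *\<^sub>v ?w"] M v by simp
  also have "\<dots> \<le> vnorm2 v * (\<beta> * vnorm2 ?w)"
    by (intro mult_left_mono \<beta>[OF w]) simp
  finally have *: "vnorm2 ?w * vnorm2 ?w \<le> (\<beta> * vnorm2 v) * vnorm2 ?w"
    by (simp add: power2_eq_square mult_ac)
  show ?thesis
  proof (cases "vnorm2 ?w = 0")
    case True
    then show ?thesis using \<open>0 \<le> \<beta>\<close> by simp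
  next
    case False
    then have "0 < vnorm2 ?w" using vnorm2_nonneg[of ?w] by linarith
    then show ?thesis using * by simp
  qed
qed

lemma vnorm_inf_transpose_mult_le:
  assumes M: "M \<in> carrier_mat n m" and v: "v \<in> carrier_vec n" and "0 \<le> \<beta>"
    and \<beta>: "\<And>z. z \<in> carrier_vec m \<Longrightarrow> vnorm1 (M *\<^sub>v z) \<le> \<beta> * vnorm1 z"
  shows "vnorm_inf (transpose_mat M *\<^sub>v v) \<le> \<beta> * vnorm_inf v"
  unfolding vnorm_inf_le_iff
proof (intro conjI allI impI)
  fix j assume "j < dim_vec (transpose_mat M *\<^sub>v v)"
  then have j: "j < m" using M by simp
  have "M *\<^sub>v unit_vec m j = col M j" using M j by (intro eq_vecI) auto
  moreover have "vnorm1 (unit_vec m j) = 1"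
    using j by (simp add: vnorm1_def unit_vec_def if_distrib[of abs] cong: if_cong)
  ultimately have col: "vnorm1 (col M j) \<le> \<beta>" using \<beta>[of "unit_vec m j"] by simp
  have "\<bar>(transpose_mat M *\<^sub>v v) $ j\<bar> \<le> vnorm1 (col M j) * vnorm_inf v"
    using abs_scalar_prod_le_vnorm1_vnorm_inf[of "col M j" v] M v j by simp
  also have "\<dots> \<le> \<beta> * vnorm_inf v" using col by (rule mult_right_mono) simp
  finally show "\<bar>(transpose_mat M *\<^sub>v v) $ j\<bar> \<le> \<beta> * vnorm_inf v" .
qed (use \<open>0 \<le> \<beta>\<close> in simp)

section \<open>Diagonal perturbations of a linear system\<close>

lemma perturbed_solution_norm_le:
  assumes A: "A \<in> carrier_mat n n" and "0 \<le> \<kappa>"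
    and \<kappa>: "\<And>v. v \<in> carrier_vec n \<Longrightarrow> vnorm2 v \<le> \<kappa> * vnorm2 (A *\<^sub>v v)"
    and w: "w \<in> carrier_vec n" and x: "x \<in> carrier_vec n"
    and eq: "A *\<^sub>v x + component_mult w x = b"
    and small: "\<kappa> * vnorm_inf w \<le> 1 / 2"
  shows "vnorm2 x \<le> 2 * \<kappa> * vnorm2 b"
proof -
  have "vnorm2 (A *\<^sub>v x) \<le> vnorm2 b + vnorm2 (A *\<^sub>v x - b)"
    using A w x by (intro vnorm2_diff_le) (auto simp: eq[symmetric] dim_component_mult)
  also have "A *\<^sub>v x - b = (-1) \<cdot>\<^sub>v component_mult w x"
    unfolding eq[symmetric] using A w x by (intro eq_vecI) (auto simp: dim_component_mult)
  finally have "vnorm2 (A *\<^sub>v x) \<le> vnorm2 b + vnorm_inf w * vnorm2 x"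
    using vnorm2_component_mult_le[OF w x] by simp
  then have "\<kappa> * vnorm2 (A *\<^sub>v x) \<le> \<kappa> * (vnorm2 b + vnorm_inf w * vnorm2 x)"
    by (rule mult_left_mono) fact
  with \<kappa>[OF x] have "vnorm2 x \<le> \<kappa> * vnorm2 b + (\<kappa> * vnorm_inf w) * vnorm2 x"
    by (simp add: algebra_simps)
  also have "(\<kappa> * vnorm_inf w) * vnorm2 x \<le> 1 / 2 * vnorm2 x"
    by (intro mult_right_mono small) simp
  finally show ?thesis by simp
qed

lemma perturbed_solution_residual:
  fixes A :: "real mat"
  assumes A: "A \<in> carrier_mat n n"
    and w: "w \<in> carrier_vec n" "w' \<in> carrier_vec n" and x: "x \<in> carrier_vec n" "x' \<in> carrier_vec n"
    and eq: "A *\<^sub>v x + component_mult w x = b" "A *\<^sub>v x' + component_mult w' x' = b"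
  shows "A *\<^sub>v (x' - x) = (-1) \<cdot>\<^sub>v (component_mult (w' - w) x' + component_mult w (x' - x))"
proof (rule eq_vecI)
  fix i assume "i < dim_vec ((-1) \<cdot>\<^sub>v (component_mult (w' - w) x' + component_mult w (x' - x)))"
  then have i: "i < n" using w x by (simp add: dim_component_mult)
  have "(A *\<^sub>v x + component_mult w x) $ i = (A *\<^sub>v x' + component_mult w' x') $ i"
    unfolding eq ..
  then have "(A *\<^sub>v x) $ i + w $ i * x $ i = (A *\<^sub>v x') $ i + w' $ i * x' $ i"
    using i A w x by (simp add: component_mult_def del: index_mult_mat_vec)
  moreover have "(A *\<^sub>v (x' - x)) $ i = (A *\<^sub>v x') $ i - (A *\<^sub>v x) $ i"
    using i A unfolding mult_minus_distrib_mat_vec[OF A x(2,1)]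
    by (simp del: index_mult_mat_vec)
  ultimately show "(A *\<^sub>v (x' - x)) $ i
      = ((-1) \<cdot>\<^sub>v (component_mult (w' - w) x' + component_mult w (x' - x))) $ i"
    using i w x by (simp add: component_mult_def algebra_simps del: index_mult_mat_vec)
qed (use A w x in \<open>simp add: dim_component_mult\<close>)

text \<open>Only one of the two perturbations has to be small, and the inverse of the perturbed matrix
  never occurs: the residual of \<open>x' - x\<close> under the unperturbed matrix contains \<open>x' - x\<close> itself
  with a factor that \<open>\<kappa>\<close> turns into at most \<open>1 / 2\<close>, so it can be absorbed. The maximum norm
  falls on the solution \<open>x'\<close>, where non-resonance controls it, and the Euclidean norm on the
  change of the perturbation.\<close>
lemma perturbed_solution_diff_le:
  assumes A: "A \<in> carrier_mat n n" and "0 \<le> \<kappa>"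
    and \<kappa>: "\<And>v. v \<in> carrier_vec n \<Longrightarrow> vnorm2 v \<le> \<kappa> * vnorm2 (A *\<^sub>v v)"
    and w: "w \<in> carrier_vec n" "w' \<in> carrier_vec n" and x: "x \<in> carrier_vec n" "x' \<in> carrier_vec n"
    and eq: "A *\<^sub>v x + component_mult w x = b" "A *\<^sub>v x' + component_mult w' x' = b"
    and small: "\<kappa> * vnorm_inf w \<le> 1 / 2"
  shows "vnorm2 (x' - x) \<le> 2 * \<kappa> * vnorm2 (w' - w) * vnorm_inf x'"
proof -
  have d: "x' - x \<in> carrier_vec n" "w' - w \<in> carrier_vec n" using x w by auto
  have "vnorm2 (A *\<^sub>v (x' - x)) \<le> vnorm2 (component_mult (w' - w) x') + vnorm2 (component_mult w (x' - x))"
    unfolding perturbed_solution_residual[OF A w x eq] using w x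
    by (simp, intro vnorm2_add_le) (simp add: dim_component_mult)
  also have "\<dots> \<le> vnorm_inf x' * vnorm2 (w' - w) + vnorm_inf w * vnorm2 (x' - x)"
    unfolding component_mult_commute[of "w' - w" x'] 
    by (intro add_mono vnorm2_component_mult_le[where n = n]) (use x w d in auto)
  finally have "\<kappa> * vnorm2 (A *\<^sub>v (x' - x))
      \<le> \<kappa> * (vnorm_inf x' * vnorm2 (w' - w) + vnorm_inf w * vnorm2 (x' - x))"
    by (rule mult_left_mono) fact
  with \<kappa>[OF d(1)] have "vnorm2 (x' - x)
      \<le> \<kappa> * vnorm2 (w' - w) * vnorm_inf x' + (\<kappa> * vnorm_inf w) * vnorm2 (x' - x)"
    by (simp add: algebra_simps)
  also have "(\<kappa> * vnorm_inf w) * vnorm2 (x' - x) \<le> 1 / 2 * vnorm2 (x' - x)"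
    by (intro mult_right_mono small) simp
  finally show ?thesis by simp
qed

text \<open>The observable changes by an exact bilinear expression in the old adjoint and the new
  solution, so its second-order error comes from \<open>x' - x\<close> alone.\<close>
lemma observable_diff:
  fixes A :: "real mat"
  assumes A: "A \<in> carrier_mat n n"
    and w: "w \<in> carrier_vec n" "w' \<in> carrier_vec n" and x: "x \<in> carrier_vec n" "x' \<in> carrier_vec n"
    and y: "y \<in> carrier_vec n"
    and eq: "A *\<^sub>v x + component_mult w x = b" "A *\<^sub>v x' + component_mult w' x' = b"
    and adj: "transpose_mat A *\<^sub>v y + component_mult w y = c"
  shows "c \<bullet> x' - c \<bullet> x = - ((w' - w) \<bullet> component_mult x' y)"
proof -
  let ?v = "x' - x"
  have v: "?v \<in> carrier_vec n" using x by auto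
  have c: "c \<in> carrier_vec n" using A w y unfolding adj[symmetric] by auto
  have "c \<bullet> x' - c \<bullet> x = c \<bullet> ?v" using scalar_prod_minus_distrib[OF c x(2,1)] by simp
  also have "\<dots> = (transpose_mat A *\<^sub>v y) \<bullet> ?v + component_mult w y \<bullet> ?v"
    unfolding adj[symmetric]
    using A w y v by (intro add_scalar_prod_distrib[where n = n]) auto
  also have "(transpose_mat A *\<^sub>v y) \<bullet> ?v = y \<bullet> (A *\<^sub>v ?v)"
    by (rule transpose_vec_mult_scalar[OF A v y])
  also have "\<dots> + component_mult w y \<bullet> ?v = - ((w' - w) \<bullet> component_mult x' y)"
    unfolding perturbed_solution_residual[OF A w x eq] using w x y
    by (simp add: scalar_prod_def component_mult_def sum.distrib[symmetric] sum_negf[symmetric])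
      (auto simp: algebra_simps intro!: sum.cong)
  finally show ?thesis .
qed

section \<open>Gradient descent at a fixed size\<close>

text \<open>One problem of the family with one run of gradient descent: \<open>\<kappa>\<close> bounds the inverse of
  \<open>A\<close> and of its transpose, \<open>\<beta>\<close> bounds \<open>B\<close> and its transpose, and \<open>s\<close> bounds source and
  observable. The states \<open>x t\<close> and adjoints \<open>y t\<close> are characterised by the linear systems that
  they solve.\<close>
locale descent_run =
  fixes f :: "real \<Rightarrow> real" and L \<mu> :: real and A B :: "real mat" and b c :: "real vec"
    and n m T :: nat and \<eta> \<kappa> \<beta> s :: real and \<theta> x y :: "nat \<Rightarrow> real vec"
  assumes convex: "strongly_convex \<mu> f" and mu_pos: "0 < \<mu>"
    and smooth: "lipschitz_smooth L f" and L_pos: "0 < L" and bdd: "bdd_below (range f)"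
    and A: "A \<in> carrier_mat n n" and B: "B \<in> carrier_mat n m"
    and nonneg: "0 \<le> \<eta>" "0 \<le> \<kappa>" "0 \<le> \<beta>" "0 \<le> s"
    and inv_A: "\<And>v. v \<in> carrier_vec n \<Longrightarrow> vnorm2 v \<le> \<kappa> * vnorm2 (A *\<^sub>v v)"
    and inv_AT: "\<And>v. v \<in> carrier_vec n \<Longrightarrow> vnorm2 v \<le> \<kappa> * vnorm2 (transpose_mat A *\<^sub>v v)"
    and B2: "\<And>v. v \<in> carrier_vec m \<Longrightarrow> vnorm2 (B *\<^sub>v v) \<le> \<beta> * vnorm2 v"
    and B_inf: "\<And>v. v \<in> carrier_vec m \<Longrightarrow> vnorm_inf (B *\<^sub>v v) \<le> \<beta> * vnorm_inf v"
    and BT2: "\<And>v. v \<in> carrier_vec n \<Longrightarrow> vnorm2 (transpose_mat B *\<^sub>v v) \<le> \<beta> * vnorm2 v"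
    and BT_inf: "\<And>v. v \<in> carrier_vec n \<Longrightarrow>
      vnorm_inf (transpose_mat B *\<^sub>v v) \<le> \<beta> * vnorm_inf v"
    and b_le: "vnorm2 b \<le> s" and c_le: "vnorm2 c \<le> s"
    and x: "\<And>t. t \<le> T \<Longrightarrow> x t \<in> carrier_vec n" and y: "\<And>t. t \<le> T \<Longrightarrow> y t \<in> carrier_vec n"
    and x_eq: "\<And>t. t \<le> T \<Longrightarrow> A *\<^sub>v x t + component_mult (B *\<^sub>v \<theta> t) (x t) = b"
    and y_eq: "\<And>t. t \<le> T \<Longrightarrow> transpose_mat A *\<^sub>v y t + component_mult (B *\<^sub>v \<theta> t) (y t) = c"
    and start: "\<theta> 0 = 0\<^sub>v m"
    and step: "\<And>t. t < T \<Longrightarrow> \<theta> (Suc t) = \<theta> t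
      + (\<eta> * deriv f (c \<bullet> x t)) \<cdot>\<^sub>v (transpose_mat B *\<^sub>v component_mult (x t) (y t))"
begin

definition u :: "nat \<Rightarrow> real" where "u t = c \<bullet> x t"

definition g :: "nat \<Rightarrow> real vec" where
  "g t = transpose_mat B *\<^sub>v component_mult (x t) (y t)"

definition gap :: "nat \<Rightarrow> real" where "gap t = f (u t) - (INF z. f z)"

lemma gap_nonneg: "0 \<le> gap t"
  unfolding gap_def using cINF_lower[of f UNIV "u t"] bdd by simp

lemma g_carrier [simp]: "t \<le> T \<Longrightarrow> g t \<in> carrier_vec m"
  unfolding g_def using B x y by simp

lemma \<theta>_carrier: "t \<le> T \<Longrightarrow> \<theta> t \<in> carrier_vec m"
proof (induction t)
  case (Suc t)
  then have "g t \<in> carrier_vec m" by simp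
  with Suc show ?case by (simp add: step g_def)
qed (simp add: start)

lemma \<theta>_Suc: "t < T \<Longrightarrow> \<theta> (Suc t) = \<theta> t + (\<eta> * deriv f (u t)) \<cdot>\<^sub>v g t"
  by (simp add: step u_def g_def)

lemma B\<theta>_carrier [simp]: "t \<le> T \<Longrightarrow> B *\<^sub>v \<theta> t \<in> carrier_vec n"
  using B \<theta>_carrier by simp

lemma B\<theta>_Suc:
  assumes "t < T"
  shows "B *\<^sub>v \<theta> (Suc t) - B *\<^sub>v \<theta> t = (\<eta> * deriv f (u t)) \<cdot>\<^sub>v (B *\<^sub>v g t)"
proof -
  have "B *\<^sub>v \<theta> (Suc t) = B *\<^sub>v \<theta> t + (\<eta> * deriv f (u t)) \<cdot>\<^sub>v (B *\<^sub>v g t)"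
    unfolding \<theta>_Suc[OF assms]
    using assms B \<theta>_carrier[of t] g_carrier[of t]
      mult_add_distrib_mat_vec[OF B, of "\<theta> t" "(\<eta> * deriv f (u t)) \<cdot>\<^sub>v g t"]
      mult_mat_vec[OF B, of "g t" "\<eta> * deriv f (u t)"]
    by simp
  then show ?thesis using B by (intro eq_vecI) (auto simp del: index_mult_mat_vec)
qed

lemma B\<theta>_0: "B *\<^sub>v \<theta> 0 = 0\<^sub>v n"
  unfolding start using B by (intro eq_vecI) auto

lemma x_norm_le:
  assumes "t \<le> T" and "\<kappa> * vnorm_inf (B *\<^sub>v \<theta> t) \<le> 1 / 2"
  shows "vnorm2 (x t) \<le> 2 * \<kappa> * s"
proof -
  have "vnorm2 (x t) \<le> 2 * \<kappa> * vnorm2 b"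
    by (rule perturbed_solution_norm_le[OF A nonneg(2) inv_A]) (use assms x x_eq in auto)
  also have "\<dots> \<le> 2 * \<kappa> * s" using b_le nonneg by (intro mult_left_mono) auto
  finally show ?thesis .
qed

lemma y_norm_le:
  assumes "t \<le> T" and "\<kappa> * vnorm_inf (B *\<^sub>v \<theta> t) \<le> 1 / 2"
  shows "vnorm2 (y t) \<le> 2 * \<kappa> * s"
proof -
  have "vnorm2 (y t) \<le> 2 * \<kappa> * vnorm2 c"
    by (rule perturbed_solution_norm_le[OF _ nonneg(2) inv_AT]) (use A assms y y_eq in auto)
  also have "\<dots> \<le> 2 * \<kappa> * s" using c_le nonneg by (intro mult_left_mono) auto
  finally show ?thesis .
qed

lemma x_diff_le:
  assumes "i \<le> T" "j \<le> T" and "\<kappa> * vnorm_inf (B *\<^sub>v \<theta> i) \<le> 1 / 2"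
  shows "vnorm2 (x j - x i) \<le> 2 * \<kappa> * vnorm2 (B *\<^sub>v \<theta> j - B *\<^sub>v \<theta> i) * vnorm_inf (x j)"
  by (rule perturbed_solution_diff_le[OF A nonneg(2) inv_A]) (use assms x x_eq in auto)

lemma y_diff_le:
  assumes "i \<le> T" "j \<le> T" and "\<kappa> * vnorm_inf (B *\<^sub>v \<theta> i) \<le> 1 / 2"
  shows "vnorm2 (y j - y i) \<le> 2 * \<kappa> * vnorm2 (B *\<^sub>v \<theta> j - B *\<^sub>v \<theta> i) * vnorm_inf (y j)"
  by (rule perturbed_solution_diff_le[OF _ nonneg(2) inv_AT]) (use A assms y y_eq in auto)

lemma g_le:
  assumes t: "t \<le> T" and small: "\<kappa> * vnorm_inf (B *\<^sub>v \<theta> t) \<le> 1 / 2"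
  shows "vnorm2 (g t) \<le> \<beta> * (2 * \<kappa> * s * vnorm_inf (x t))"
    and "vnorm2 (g t) \<le> \<beta> * (2 * \<kappa> * s * vnorm_inf (y t))"
proof -
  have g: "vnorm2 (g t) \<le> \<beta> * r" if "vnorm2 (component_mult (x t) (y t)) \<le> r" for r
  proof -
    have "vnorm2 (g t) \<le> \<beta> * vnorm2 (component_mult (x t) (y t))"
      unfolding g_def using x y t by (intro BT2) simp
    also have "\<dots> \<le> \<beta> * r" using that nonneg by (intro mult_left_mono)
    finally show ?thesis .
  qed
  have "vnorm2 (component_mult (x t) (y t)) \<le> vnorm_inf (x t) * vnorm2 (y t)"
    using x y t by (intro vnorm2_component_mult_le)
  also have "\<dots> \<le> vnorm_inf (x t) * (2 * \<kappa> * s)"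
    using y_norm_le[OF t small] by (rule mult_left_mono) simp
  finally show "vnorm2 (g t) \<le> \<beta> * (2 * \<kappa> * s * vnorm_inf (x t))"
    by (intro g) (simp add: mult_ac)
  have "vnorm2 (component_mult (y t) (x t)) \<le> vnorm_inf (y t) * vnorm2 (x t)"
    using x y t by (intro vnorm2_component_mult_le)
  also have "\<dots> \<le> vnorm_inf (y t) * (2 * \<kappa> * s)"
    using x_norm_le[OF t small] by (rule mult_left_mono) simp
  finally show "vnorm2 (g t) \<le> \<beta> * (2 * \<kappa> * s * vnorm_inf (y t))"
    by (intro g) (simp add: mult_ac component_mult_commute)
qed

lemma B\<theta>_step_le:
  assumes t: "t < T" and D: "\<bar>deriv f (u t)\<bar> \<le> D"
  shows "vnorm2 (B *\<^sub>v \<theta> (Suc t) - B *\<^sub>v \<theta> t) \<le> \<eta> * D * \<beta> * vnorm2 (g t)"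
proof -
  have "vnorm2 (B *\<^sub>v \<theta> (Suc t) - B *\<^sub>v \<theta> t) = \<eta> * \<bar>deriv f (u t)\<bar> * vnorm2 (B *\<^sub>v g t)"
    using nonneg by (simp add: B\<theta>_Suc[OF t] abs_mult)
  also have "\<dots> \<le> \<eta> * D * (\<beta> * vnorm2 (g t))"
    using D t nonneg by (intro mult_mono B2) auto
  finally show ?thesis by (simp add: mult.assoc)
qed

text \<open>Non-resonance speaks of the generated designs, hence not of the starting point. The starting
  state and adjoint inherit the bound from the first design: each of them differs from its
  successor by at most a small multiple of the other, and the two inequalities close up.\<close>
lemma start_not_resonant:
  assumes T: "1 \<le> T" and R: "vnorm_inf (x 1) \<le> R" "vnorm_inf (y 1) \<le> R"
    and D: "\<bar>deriv f (u 0)\<bar> \<le> D"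
    and q: "4 * \<kappa>\<^sup>2 * \<beta>\<^sup>2 * \<eta> * D * s * R \<le> 1 / 2"
  shows "vnorm_inf (x 0) \<le> 2 * R" "vnorm_inf (y 0) \<le> 2 * R"
proof -
  define q where "q = 4 * \<kappa>\<^sup>2 * \<beta>\<^sup>2 * \<eta> * D * s * R"
  have R0: "0 \<le> R" using R(1) vnorm_inf_nonneg[of "x 1"] by linarith
  have D0: "0 \<le> D" using D by linarith
  have small: "\<kappa> * vnorm_inf (B *\<^sub>v \<theta> 0) \<le> 1 / 2" by (simp add: B\<theta>_0 vnorm_inf_def image_constant_conv)
  have move: "vnorm2 (B *\<^sub>v \<theta> 1 - B *\<^sub>v \<theta> 0) \<le> \<eta> * D * \<beta> * (\<beta> * (2 * \<kappa> * s * Z))"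
    if "vnorm2 (g 0) \<le> \<beta> * (2 * \<kappa> * s * Z)" for Z
  proof -
    have "vnorm2 (B *\<^sub>v \<theta> 1 - B *\<^sub>v \<theta> 0) \<le> \<eta> * D * \<beta> * vnorm2 (g 0)"
      using B\<theta>_step_le[of 0 D] T D by simp
    also have "\<dots> \<le> \<eta> * D * \<beta> * (\<beta> * (2 * \<kappa> * s * Z))"
      using that nonneg D0 by (intro mult_left_mono) auto
    finally show ?thesis .
  qed
  note g0 = g_le[OF le0 small]
  have "vnorm_inf (x 0) \<le> vnorm_inf (x 1) + vnorm2 (x 1 - x 0)"
    using vnorm_inf_diff_le[of "x 0" "x 1"] vnorm_inf_le_vnorm2[of "x 0 - x 1"]
      vnorm2_minus_commute[of "x 0" "x 1"] x[of 0] x[of 1] T by simp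
  also have "vnorm2 (x 1 - x 0) \<le> 2 * \<kappa> * (\<eta> * D * \<beta> * (\<beta> * (2 * \<kappa> * s * vnorm_inf (y 0)))) * R"
  proof (rule order.trans[OF x_diff_le[OF le0 T small]])
    show "2 * \<kappa> * vnorm2 (B *\<^sub>v \<theta> 1 - B *\<^sub>v \<theta> 0) * vnorm_inf (x 1)
        \<le> 2 * \<kappa> * (\<eta> * D * \<beta> * (\<beta> * (2 * \<kappa> * s * vnorm_inf (y 0)))) * R"
      using move[OF g0(2)] R nonneg D0 by (intro mult_mono mult_left_mono) auto
  qed
  also have "\<dots> = q * vnorm_inf (y 0)" by (simp add: q_def power2_eq_square)
  finally have X: "vnorm_inf (x 0) \<le> R + q * vnorm_inf (y 0)" using R by simp
  have "vnorm_inf (y 0) \<le> vnorm_inf (y 1) + vnorm2 (y 1 - y 0)"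
    using vnorm_inf_diff_le[of "y 0" "y 1"] vnorm_inf_le_vnorm2[of "y 0 - y 1"]
      vnorm2_minus_commute[of "y 0" "y 1"] y[of 0] y[of 1] T by simp
  also have "vnorm2 (y 1 - y 0) \<le> 2 * \<kappa> * (\<eta> * D * \<beta> * (\<beta> * (2 * \<kappa> * s * vnorm_inf (x 0)))) * R"
  proof (rule order.trans[OF y_diff_le[OF le0 T small]])
    show "2 * \<kappa> * vnorm2 (B *\<^sub>v \<theta> 1 - B *\<^sub>v \<theta> 0) * vnorm_inf (y 1)
        \<le> 2 * \<kappa> * (\<eta> * D * \<beta> * (\<beta> * (2 * \<kappa> * s * vnorm_inf (x 0)))) * R"
      using move[OF g0(1)] R nonneg D0 by (intro mult_mono mult_left_mono) auto
  qed
  also have "\<dots> = q * vnorm_inf (x 0)" by (simp add: q_def power2_eq_square)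
  finally have Y: "vnorm_inf (y 0) \<le> R + q * vnorm_inf (x 0)" using R by simp
  have "q * z \<le> 1 / 2 * z" if "0 \<le> z" for z
    using assms(5) that unfolding q_def by (rule mult_right_mono)
  from this[of "vnorm_inf (y 0)"] this[of "vnorm_inf (x 0)"]
  have "q * vnorm_inf (y 0) \<le> 1 / 2 * vnorm_inf (y 0)" "q * vnorm_inf (x 0) \<le> 1 / 2 * vnorm_inf (x 0)"
    by simp_all
  with X Y show "vnorm_inf (x 0) \<le> 2 * R" "vnorm_inf (y 0) \<le> 2 * R" by linarith+
qed

lemma small_perturbation:
  assumes t: "t \<le> T" and \<theta>: "vnorm_inf (\<theta> t) \<le> r" and r: "\<kappa> * \<beta> * r \<le> 1 / 2"
  shows "\<kappa> * vnorm_inf (B *\<^sub>v \<theta> t) \<le> 1 / 2"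
proof -
  have "\<kappa> * vnorm_inf (B *\<^sub>v \<theta> t) \<le> \<kappa> * (\<beta> * vnorm_inf (\<theta> t))"
    using nonneg t by (intro mult_left_mono B_inf \<theta>_carrier) auto
  also have "\<dots> \<le> \<kappa> * (\<beta> * r)" using \<theta> nonneg by (intro mult_left_mono) auto
  finally show ?thesis using r by (simp add: mult.assoc)
qed

text \<open>The first-order change of the observable is \<open>\<eta> * (vnorm2 (g t))\<^sup>2\<close> times minus the
  derivative. The second-order change is bounded by half of that, so that the observable performs
  a one-dimensional gradient step of nearly that length.\<close>
lemma observable_step:
  assumes t: "t < T" and small: "\<kappa> * vnorm_inf (B *\<^sub>v \<theta> t) \<le> 1 / 2"
    and R: "vnorm_inf (x (Suc t)) \<le> R" "vnorm_inf (y t) \<le> R"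
    and D: "\<bar>deriv f (u t)\<bar> \<le> D"
    and h: "2 * \<kappa> * \<beta>\<^sup>2 * R\<^sup>2 * \<eta> * D \<le> 1 / 2"
  obtains r where "u (Suc t) = u t - r * deriv f (u t)"
    "\<eta> * (vnorm2 (g t))\<^sup>2 / 2 \<le> r" "r \<le> 3 / 2 * \<eta> * (vnorm2 (g t))\<^sup>2"
proof -
  define \<Delta> where "\<Delta> = component_mult (y t) (x (Suc t) - x t)"
  define e where "e = (B *\<^sub>v g t) \<bullet> \<Delta>"
  have R0: "0 \<le> R" using R(1) vnorm_inf_nonneg[of "x (Suc t)"] by linarith
  have D0: "0 \<le> D" using D by linarith
  have carr: "x t \<in> carrier_vec n" "x (Suc t) \<in> carrier_vec n" "y t \<in> carrier_vec n"
    "B *\<^sub>v g t \<in> carrier_vec n" "g t \<in> carrier_vec m" "\<Delta> \<in> carrier_vec n"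
    using x[of t] x[of "Suc t"] y[of t] B t g_carrier[of t] by (auto simp: \<Delta>_def)
  have "vnorm2 \<Delta> \<le> vnorm_inf (y t) * vnorm2 (x (Suc t) - x t)"
    unfolding \<Delta>_def using carr by (intro vnorm2_component_mult_le[where n = n]) auto
  also have "vnorm2 (x (Suc t) - x t) \<le> 2 * \<kappa> * vnorm2 (B *\<^sub>v \<theta> (Suc t) - B *\<^sub>v \<theta> t) * vnorm_inf (x (Suc t))"
    using x_diff_le[of t "Suc t"] small t by simp
  also have "\<dots> \<le> 2 * \<kappa> * (\<eta> * D * \<beta> * vnorm2 (g t)) * R"
    using B\<theta>_step_le[OF t D] R nonneg D0 by (intro mult_mono mult_left_mono) auto
  also have "vnorm_inf (y t) * (2 * \<kappa> * (\<eta> * D * \<beta> * vnorm2 (g t)) * R)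
      \<le> R * (2 * \<kappa> * (\<eta> * D * \<beta> * vnorm2 (g t)) * R)"
    using R R0 D0 nonneg by (intro mult_right_mono) auto
  finally have \<Delta>_le: "vnorm2 \<Delta> \<le> R * (2 * \<kappa> * (\<eta> * D * \<beta> * vnorm2 (g t)) * R)"
    by (simp add: mult_left_mono)
  have "\<bar>e\<bar> \<le> vnorm2 (B *\<^sub>v g t) * vnorm2 \<Delta>"
    unfolding e_def using carr B by (intro abs_scalar_prod_le_vnorm2) auto
  also have "\<dots> \<le> (\<beta> * vnorm2 (g t)) * (R * (2 * \<kappa> * (\<eta> * D * \<beta> * vnorm2 (g t)) * R))"
    using B2[OF carr(5)] \<Delta>_le nonneg by (intro mult_mono) auto
  also have "\<dots> = (2 * \<kappa> * \<beta>\<^sup>2 * R\<^sup>2 * \<eta> * D) * (vnorm2 (g t))\<^sup>2"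
    by (simp add: power2_eq_square)
  also have "\<dots> \<le> 1 / 2 * (vnorm2 (g t))\<^sup>2" using h by (rule mult_right_mono) simp
  finally have e: "\<bar>e\<bar> \<le> 1 / 2 * (vnorm2 (g t))\<^sup>2" .
  have "u (Suc t) - u t = - ((B *\<^sub>v \<theta> (Suc t) - B *\<^sub>v \<theta> t) \<bullet> component_mult (x (Suc t)) (y t))"
    unfolding u_def
    by (rule observable_diff[OF A]) (use t x y x_eq y_eq in auto)
  also have "\<dots> = - (\<eta> * deriv f (u t) * ((B *\<^sub>v g t) \<bullet> component_mult (x (Suc t)) (y t)))"
    unfolding B\<theta>_Suc[OF t] using smult_scalar_prod_distrib[OF carr(4), of "component_mult (x (Suc t)) (y t)"] carr
    by simp
  also have "(B *\<^sub>v g t) \<bullet> component_mult (x (Suc t)) (y t) = (B *\<^sub>v g t) \<bullet> component_mult (x t) (y t) + e"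
    unfolding e_def \<Delta>_def using carr B
    by (simp add: scalar_prod_def component_mult_def sum.distrib[symmetric] algebra_simps
        del: index_mult_mat_vec)
  also have "(B *\<^sub>v g t) \<bullet> component_mult (x t) (y t) = g t \<bullet> g t"
  proof -
    have "g t \<bullet> g t = component_mult (x t) (y t) \<bullet> (B *\<^sub>v g t)"
      using transpose_vec_mult_scalar[OF B carr(5), of "component_mult (x t) (y t)"] carr
      by (simp add: g_def)
    also have "\<dots> = (B *\<^sub>v g t) \<bullet> component_mult (x t) (y t)"
      by (rule comm_scalar_prod[where n = n]) (use carr in auto)
    finally show ?thesis ..
  qed
  finally have "u (Suc t) = u t - \<eta> * ((vnorm2 (g t))\<^sup>2 + e) * deriv f (u t)"
    by (simp add: vnorm2_square algebra_simps)
  moreover have "\<eta> * ((vnorm2 (g t))\<^sup>2 / 2) \<le> \<eta> * ((vnorm2 (g t))\<^sup>2 + e)"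
    "\<eta> * ((vnorm2 (g t))\<^sup>2 + e) \<le> \<eta> * (3 / 2 * (vnorm2 (g t))\<^sup>2)"
    by (rule mult_left_mono; use e nonneg in linarith)+
  ultimately show ?thesis by (intro that[of "\<eta> * ((vnorm2 (g t))\<^sup>2 + e)"]) auto
qed

text \<open>The gradient of the observable hardly moves: by bilinearity its change splits into one term
  with the change of the state and one with the change of the adjoint.\<close>
lemma g_diff_le:
  assumes t: "t \<le> T"
    and R: "vnorm_inf (x 0) \<le> R" "vnorm_inf (x t) \<le> R" "vnorm_inf (y t) \<le> R"
    and \<theta>: "vnorm2 (\<theta> t) \<le> r"
  shows "vnorm2 (g t - g 0) \<le> 4 * \<kappa> * \<beta>\<^sup>2 * r * R\<^sup>2"
proof -
  have R0: "0 \<le> R" using R(1) vnorm_inf_nonneg[of "x 0"] by linarith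
  have small: "\<kappa> * vnorm_inf (B *\<^sub>v \<theta> 0) \<le> 1 / 2"
    by (simp add: B\<theta>_0 vnorm_inf_def image_constant_conv)
  have carr: "x t \<in> carrier_vec n" "x 0 \<in> carrier_vec n" "y t \<in> carrier_vec n" "y 0 \<in> carrier_vec n"
    using x y t by auto
  define p q where "p = component_mult (y t) (x t - x 0)" and "q = component_mult (x 0) (y t - y 0)"
  have pq: "p \<in> carrier_vec n" "q \<in> carrier_vec n" using carr by (auto simp: p_def q_def)
  have "B *\<^sub>v \<theta> t - B *\<^sub>v \<theta> 0 = B *\<^sub>v \<theta> t"
    unfolding B\<theta>_0 using B\<theta>_carrier[OF t] by (intro eq_vecI) (auto simp del: index_mult_mat_vec)
  then have Br: "vnorm2 (B *\<^sub>v \<theta> t - B *\<^sub>v \<theta> 0) \<le> \<beta> * r"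
    using B2[OF \<theta>_carrier[OF t]] mult_left_mono[OF \<theta>, of \<beta>] nonneg by simp
  have dx: "vnorm2 (x t - x 0) \<le> 2 * \<kappa> * (\<beta> * r) * R"
  proof (rule order.trans[OF x_diff_le[OF le0 t small]])
    show "2 * \<kappa> * vnorm2 (B *\<^sub>v \<theta> t - B *\<^sub>v \<theta> 0) * vnorm_inf (x t) \<le> 2 * \<kappa> * (\<beta> * r) * R"
      using Br R nonneg order.trans[OF vnorm2_nonneg Br] by (intro mult_mono mult_left_mono) auto
  qed
  have dy: "vnorm2 (y t - y 0) \<le> 2 * \<kappa> * (\<beta> * r) * R"
  proof (rule order.trans[OF y_diff_le[OF le0 t small]])
    show "2 * \<kappa> * vnorm2 (B *\<^sub>v \<theta> t - B *\<^sub>v \<theta> 0) * vnorm_inf (y t) \<le> 2 * \<kappa> * (\<beta> * r) * R"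
      using Br R nonneg order.trans[OF vnorm2_nonneg Br] by (intro mult_mono mult_left_mono) auto
  qed
  have "component_mult (x t) (y t) - component_mult (x 0) (y 0) = p + q"
    unfolding p_def q_def using carr
    by (intro eq_vecI) (auto simp: component_mult_def algebra_simps)
  then have "g t - g 0 = transpose_mat B *\<^sub>v (p + q)"
    unfolding g_def using carr B
    by (simp add: mult_minus_distrib_mat_vec[of "transpose_mat B" m n, symmetric])
  then have "vnorm2 (g t - g 0) \<le> \<beta> * vnorm2 (p + q)" using BT2[of "p + q"] pq by simp
  also have "vnorm2 (p + q) \<le> vnorm2 p + vnorm2 q" using pq by (intro vnorm2_add_le) auto
  also have "vnorm2 p \<le> vnorm_inf (y t) * vnorm2 (x t - x 0)"
    unfolding p_def using carr by (intro vnorm2_component_mult_le[where n = n]) auto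
  also have "\<dots> \<le> R * (2 * \<kappa> * (\<beta> * r) * R)" using R R0 dx by (intro mult_mono) auto
  also have "vnorm2 q \<le> vnorm_inf (x 0) * vnorm2 (y t - y 0)"
    unfolding q_def using carr by (intro vnorm2_component_mult_le[where n = n]) auto
  also have "\<dots> \<le> R * (2 * \<kappa> * (\<beta> * r) * R)" using R R0 dy by (intro mult_mono) auto
  finally have "vnorm2 (g t - g 0)
      \<le> \<beta> * (R * (2 * \<kappa> * (\<beta> * r) * R) + R * (2 * \<kappa> * (\<beta> * r) * R))"
    using nonneg by (simp add: mult_left_mono)
  also have "\<dots> = 4 * \<kappa> * \<beta>\<^sup>2 * r * R\<^sup>2" by (simp add: power2_eq_square)
  finally show ?thesis .
qed

text \<open>The four smallness conditions say, in this order, that the whole run perturbs \<open>A\<close> little,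
  that it moves the gradient of the observable by at most half of its initial size, that the
  second-order change of a step is dominated by its first-order change, and that a step of the
  observable is short for the smoothness of \<open>f\<close>. The distances travelled and the gap have to be
  controlled in one induction: a step is short because the gap, hence the derivative, has not
  grown, and the gap shrinks because the design has not travelled far.\<close>
lemma gap_contracts:
  assumes R: "\<And>t. t \<le> T \<Longrightarrow> vnorm_inf (x t) \<le> R" "\<And>t. t \<le> T \<Longrightarrow> vnorm_inf (y t) \<le> R"
    and D: "0 \<le> D" "4 * L * gap 0 \<le> D\<^sup>2"
    and \<rho>: "0 \<le> \<rho>" "\<rho> \<le> vnorm2 (g 0)"
    and travel: "\<kappa> * \<beta> * (T * (\<eta> * D * \<beta> * R\<^sup>2)) \<le> 1 / 2"
    and gradient: "4 * \<kappa> * \<beta>\<^sup>2 * (T * (\<eta> * D * (\<beta> * (2 * \<kappa> * s * R)))) * R\<^sup>2 \<le> \<rho> / 2"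
    and second_order: "2 * \<kappa> * \<beta>\<^sup>2 * R\<^sup>2 * \<eta> * D \<le> 1 / 2"
    and step_size: "3 * L * \<eta> * (\<beta> * (2 * \<kappa> * s * R))\<^sup>2 \<le> 1"
  shows "gap T \<le> exp (- (\<mu> * \<eta> * \<rho>\<^sup>2 / 8) * T) * gap 0"
proof -
  define \<sigma> where "\<sigma> = \<mu> * \<eta> * \<rho>\<^sup>2 / 8"
  define V where "V = \<beta> * (2 * \<kappa> * s * R)"
  have R0: "0 \<le> R" using R(1)[of 0] vnorm_inf_nonneg[of "x 0"] by linarith
  have V0: "0 \<le> V" using R0 nonneg by (simp add: V_def)
  have \<sigma>0: "0 \<le> \<sigma>" using mu_pos nonneg by (simp add: \<sigma>_def)
  have "gap t \<le> exp (- \<sigma> * t) * gap 0 \<and> vnorm_inf (\<theta> t) \<le> t * (\<eta> * D * \<beta> * R\<^sup>2)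
      \<and> vnorm2 (\<theta> t) \<le> t * (\<eta> * D * V)" if "t \<le> T" for t
    using that
  proof (induction t)
    case 0
    then show ?case using vnorm2_square[of "0\<^sub>v m"] 
      by (auto simp: start vnorm_inf_def image_constant_conv scalar_prod_def)
  next
    case (Suc t)
    then have t: "t < T" "t \<le> T"
      and IH: "gap t \<le> exp (- \<sigma> * t) * gap 0" "vnorm_inf (\<theta> t) \<le> t * (\<eta> * D * \<beta> * R\<^sup>2)"
        "vnorm2 (\<theta> t) \<le> t * (\<eta> * D * V)" by auto
    have "vnorm_inf (\<theta> t) \<le> T * (\<eta> * D * \<beta> * R\<^sup>2)"
      using t D nonneg by (intro order.trans[OF IH(2)] mult_right_mono) auto
    then have small: "\<kappa> * vnorm_inf (B *\<^sub>v \<theta> t) \<le> 1 / 2"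
      using travel by (intro small_perturbation t)
    have "exp (- \<sigma> * t) \<le> 1" using \<sigma>0 by simp
    then have "gap t \<le> gap 0"
      using IH(1) mult_right_mono[of "exp (- \<sigma> * t)" 1 "gap 0"] gap_nonneg[of 0] by simp
    then have "4 * L * gap t \<le> 4 * L * gap 0" using L_pos by (intro mult_left_mono) auto
    moreover have "(deriv f (u t))\<^sup>2 \<le> 4 * L * gap t"
      unfolding gap_def by (rule deriv_square_le_gap[OF convex mu_pos smooth L_pos bdd])
    ultimately have "(deriv f (u t))\<^sup>2 \<le> D\<^sup>2" using D(2) by linarith
    then have Dt: "\<bar>deriv f (u t)\<bar> \<le> D" using D(1) by (simp add: abs_le_square_iff[symmetric])
    have gV: "vnorm2 (g t) \<le> V"
    proof (rule order.trans[OF g_le(1)[OF t(2) small]])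
      show "\<beta> * (2 * \<kappa> * s * vnorm_inf (x t)) \<le> V"
        unfolding V_def using R(1)[OF t(2)] nonneg by (intro mult_left_mono) auto
    qed
    have "vnorm2 (\<theta> t) \<le> T * (\<eta> * D * V)"
      using t D nonneg V0 by (intro order.trans[OF IH(3)] mult_right_mono) auto
    then have "vnorm2 (g t - g 0) \<le> \<rho> / 2"
      using g_diff_le[OF t(2) R(1) R(1) R(2), of "T * (\<eta> * D * V)"] t gradient
      by (auto simp: V_def)
    moreover have "vnorm2 (g 0) \<le> vnorm2 (g t) + vnorm2 (g t - g 0)"
      using vnorm2_diff_le[of "g 0" "g t"] vnorm2_minus_commute[of "g 0" "g t"]
        g_carrier[OF t(2), THEN carrier_vecD] g_carrier[OF le0, THEN carrier_vecD] by simp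
    ultimately have g\<rho>: "\<rho> / 2 \<le> vnorm2 (g t)" using \<rho> by linarith
    obtain r where r: "u (Suc t) = u t - r * deriv f (u t)"
      "\<eta> * (vnorm2 (g t))\<^sup>2 / 2 \<le> r" "r \<le> 3 / 2 * \<eta> * (vnorm2 (g t))\<^sup>2"
      using observable_step[OF t(1) small R(1) R(2) Dt second_order] t by auto
    have "\<eta> * ((\<rho> / 2)\<^sup>2 / 2) \<le> \<eta> * ((vnorm2 (g t))\<^sup>2 / 2)"
      using g\<rho> \<rho> nonneg by (intro mult_left_mono divide_right_mono power_mono) auto
    then have "\<eta> * \<rho>\<^sup>2 / 8 \<le> r" using r(2) by (simp add: power_divide)
    then have \<sigma>r: "\<sigma> \<le> \<mu> * r" "0 \<le> r"
      using mult_left_mono[of "\<eta> * \<rho>\<^sup>2 / 8" r \<mu>] mu_pos nonneg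
        order.trans[of 0 "\<eta> * \<rho>\<^sup>2 / 8" r] by (auto simp: \<sigma>_def mult.assoc)
    have "2 * L * r \<le> 2 * L * (3 / 2 * \<eta> * (vnorm2 (g t))\<^sup>2)"
      using r(3) L_pos by (intro mult_left_mono) auto
    also have "\<dots> \<le> 2 * L * (3 / 2 * \<eta> * V\<^sup>2)"
      using gV L_pos nonneg by (intro mult_left_mono power_mono) auto
    finally have "2 * L * r \<le> 1" using step_size by (simp add: V_def)
    then have "gap (Suc t) \<le> (1 - \<mu> * r) * gap t"
      unfolding gap_def r(1) using \<sigma>r
      by (intro gradient_step_contracts[OF convex mu_pos smooth])
    also have "\<dots> \<le> exp (- \<sigma>) * gap t"
      using \<sigma>r(1) exp_ge_add_one_self[of "- \<sigma>"] gap_nonneg[of t] by (intro mult_right_mono) auto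
    also have "\<dots> \<le> exp (- \<sigma>) * (exp (- \<sigma> * t) * gap 0)" using IH(1) by (intro mult_left_mono) auto
    also have "\<dots> = exp (- \<sigma> * Suc t) * gap 0"
      by (simp add: mult.assoc[symmetric] exp_add[symmetric] algebra_simps)
    finally have 1: "gap (Suc t) \<le> exp (- \<sigma> * Suc t) * gap 0" .
    have carr: "\<theta> t \<in> carrier_vec m" "g t \<in> carrier_vec m" using t \<theta>_carrier by auto
    have "vnorm_inf (g t) \<le> \<beta> * vnorm_inf (component_mult (x t) (y t))"
      unfolding g_def using x y t by (intro BT_inf) auto
    also have "vnorm_inf (component_mult (x t) (y t)) \<le> vnorm_inf (x t) * vnorm_inf (y t)"
      using x y t by (intro vnorm_inf_component_mult_le[where n = n]) auto
    also have "\<dots> \<le> R * R" using R t R0 by (intro mult_mono) auto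
    finally have g_inf: "vnorm_inf (g t) \<le> \<beta> * R\<^sup>2"
      using nonneg by (simp add: power2_eq_square mult_left_mono)
    have "vnorm_inf (\<theta> (Suc t)) \<le> vnorm_inf (\<theta> t) + vnorm_inf ((\<eta> * deriv f (u t)) \<cdot>\<^sub>v g t)"
      unfolding \<theta>_Suc[OF t(1)] using carr by (intro vnorm_inf_add_le) auto
    also have "vnorm_inf ((\<eta> * deriv f (u t)) \<cdot>\<^sub>v g t) \<le> \<eta> * \<bar>deriv f (u t)\<bar> * vnorm_inf (g t)"
      using vnorm_inf_smult_le[of "\<eta> * deriv f (u t)" "g t"] nonneg by (simp add: abs_mult)
    also have "\<dots> \<le> \<eta> * D * (\<beta> * R\<^sup>2)" using Dt g_inf nonneg D by (intro mult_mono) auto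
    finally have 2: "vnorm_inf (\<theta> (Suc t)) \<le> Suc t * (\<eta> * D * \<beta> * R\<^sup>2)"
      using IH(2) by (simp add: algebra_simps)
    have "vnorm2 (\<theta> (Suc t)) \<le> vnorm2 (\<theta> t) + vnorm2 ((\<eta> * deriv f (u t)) \<cdot>\<^sub>v g t)"
      unfolding \<theta>_Suc[OF t(1)] using carr by (intro vnorm2_add_le) auto
    also have "vnorm2 ((\<eta> * deriv f (u t)) \<cdot>\<^sub>v g t) = \<eta> * \<bar>deriv f (u t)\<bar> * vnorm2 (g t)"
      using nonneg by (simp add: abs_mult)
    also have "\<dots> \<le> \<eta> * D * V" using Dt gV nonneg D by (intro mult_mono) auto
    finally have 3: "vnorm2 (\<theta> (Suc t)) \<le> Suc t * (\<eta> * D * V)"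
      using IH(3) by (simp add: algebra_simps)
    show ?case using 1 2 3 by blast
  qed
  then show ?thesis by (simp add: \<sigma>_def)
qed

text \<open>A bound \<open>r\<close> for the generated designs serves as the bound \<open>2 * r\<close> for the whole run.\<close>
lemma gap_after_run:
  assumes T: "1 \<le> T"
    and r: "\<And>t. 1 \<le> t \<Longrightarrow> t \<le> T \<Longrightarrow> vnorm_inf (x t) \<le> r"
      "\<And>t. 1 \<le> t \<Longrightarrow> t \<le> T \<Longrightarrow> vnorm_inf (y t) \<le> r"
    and D: "0 \<le> D" "4 * L * gap 0 \<le> D\<^sup>2"
    and \<rho>: "0 \<le> \<rho>" "\<rho> \<le> vnorm2 (g 0)"
    and start: "4 * \<kappa>\<^sup>2 * \<beta>\<^sup>2 * \<eta> * D * s * r \<le> 1 / 2"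
    and travel: "\<kappa> * \<beta> * (T * (\<eta> * D * \<beta> * (2 * r)\<^sup>2)) \<le> 1 / 2"
    and gradient: "4 * \<kappa> * \<beta>\<^sup>2 * (T * (\<eta> * D * (\<beta> * (2 * \<kappa> * s * (2 * r))))) * (2 * r)\<^sup>2 \<le> \<rho> / 2"
    and second_order: "2 * \<kappa> * \<beta>\<^sup>2 * (2 * r)\<^sup>2 * \<eta> * D \<le> 1 / 2"
    and step_size: "3 * L * \<eta> * (\<beta> * (2 * \<kappa> * s * (2 * r)))\<^sup>2 \<le> 1"
  shows "gap T \<le> exp (- (\<mu> * \<eta> * \<rho>\<^sup>2 / 8) * T) * gap 0"
proof (rule gap_contracts[OF _ _ D \<rho> travel gradient second_order step_size])
  have "(deriv f (u 0))\<^sup>2 \<le> 4 * L * gap 0"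
    unfolding gap_def by (rule deriv_square_le_gap[OF convex mu_pos smooth L_pos bdd])
  then have "(deriv f (u 0))\<^sup>2 \<le> D\<^sup>2" using D(2) by (rule order.trans)
  then have "\<bar>deriv f (u 0)\<bar> \<le> D" using D(1) by (simp add: abs_le_square_iff[symmetric])
  note zero = start_not_resonant[OF T r(1)[OF order.refl T] r(2)[OF order.refl T] this start]
  have r0: "0 \<le> r" using r(1)[OF order.refl T] vnorm_inf_nonneg[of "x 1"] by linarith
  fix t assume "t \<le> T"
  then show "vnorm_inf (x t) \<le> 2 * r" "vnorm_inf (y t) \<le> 2 * r"
    using zero r(1)[of t] r(2)[of t] r0 by (cases "t = 0"; simp)+
qed

end

section \<open>Runs of gradient descent on a physical system\<close>

lemma mat_diag_mult_vec:
  "w \<in> carrier_vec n \<Longrightarrow> v \<in> carrier_vec n \<Longrightarrow>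
    mat_diag n (\<lambda>i. w $ i) *\<^sub>v v = component_mult w (v :: real vec)"
  by (intro eq_vecI)
    (auto simp: mat_diag_def component_mult_def scalar_prod_def if_distrib[of "\<lambda>a. a * _"]
      cong: if_cong)

lemma physical_system_dim_col: "physical_system n m \<phi> \<Longrightarrow> m = dim_col (sysB \<phi>)"
  by (auto simp: physical_system_def)

lemma sys_mat_0:
  assumes "physical_system n m \<phi>"
  shows "sys_mat \<phi> (0\<^sub>v m) = sysA \<phi>"
  using assms by (intro eq_matI) (auto simp: physical_system_def sys_mat_def mat_diag_def)

lemma sys_state_equation:
  assumes sys: "physical_system n m \<phi>" and \<theta>: "\<theta> \<in> sys_dom \<phi>"
  shows "sys_state \<phi> \<theta> \<in> carrier_vec n"
    and "sysA \<phi> *\<^sub>v sys_state \<phi> \<theta> + component_mult (sysB \<phi> *\<^sub>v \<theta>) (sys_state \<phi> \<theta>) = sysb \<phi>"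
proof -
  from sys have A: "sysA \<phi> \<in> carrier_mat n n" and B: "sysB \<phi> \<in> carrier_mat n m"
    and b: "sysb \<phi> \<in> carrier_vec n" by (auto simp: physical_system_def)
  from \<theta> B have \<theta>c: "\<theta> \<in> carrier_vec m" and inv: "invertible_mat (sys_mat \<phi> \<theta>)"
    by (auto simp: sys_dom_def)
  have w: "sysB \<phi> *\<^sub>v \<theta> \<in> carrier_vec n" using B \<theta>c by simp
  have M: "sys_mat \<phi> \<theta> = sysA \<phi> + mat_diag n (\<lambda>i. (sysB \<phi> *\<^sub>v \<theta>) $ i)"
    using B by (simp add: sys_mat_def)
  have Mc: "sys_mat \<phi> \<theta> \<in> carrier_mat n n" unfolding M using A by simp
  note mi = minv[OF Mc inv]
  show x: "sys_state \<phi> \<theta> \<in> carrier_vec n" unfolding sys_state_def using mi(1) b by simp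
  have "sys_mat \<phi> \<theta> *\<^sub>v sys_state \<phi> \<theta> = (sys_mat \<phi> \<theta> * minv (sys_mat \<phi> \<theta>)) *\<^sub>v sysb \<phi>"
    unfolding sys_state_def using assoc_mult_mat_vec[OF Mc mi(1) b] by simp
  also have "\<dots> = sysb \<phi>" using mi(2) b by simp
  finally show "sysA \<phi> *\<^sub>v sys_state \<phi> \<theta> + component_mult (sysB \<phi> *\<^sub>v \<theta>) (sys_state \<phi> \<theta>) = sysb \<phi>"
    using add_mult_distrib_mat_vec[OF A _ x, of "mat_diag n (\<lambda>i. (sysB \<phi> *\<^sub>v \<theta>) $ i)"]
      mat_diag_mult_vec[OF w x] by (simp add: M)
qed

lemma sys_adjoint_equation:
  assumes sys: "physical_system n m \<phi>" and \<theta>: "\<theta> \<in> sys_dom \<phi>" and c: "c \<in> carrier_vec n"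
  shows "sys_adjoint \<phi> \<theta> c \<in> carrier_vec n"
    and "transpose_mat (sysA \<phi>) *\<^sub>v sys_adjoint \<phi> \<theta> c
      + component_mult (sysB \<phi> *\<^sub>v \<theta>) (sys_adjoint \<phi> \<theta> c) = c"
proof -
  from sys have A: "sysA \<phi> \<in> carrier_mat n n" and B: "sysB \<phi> \<in> carrier_mat n m"
    by (auto simp: physical_system_def)
  from \<theta> B have \<theta>c: "\<theta> \<in> carrier_vec m" and inv: "invertible_mat (sys_mat \<phi> \<theta>)"
    by (auto simp: sys_dom_def)
  define W where "W = mat_diag n (\<lambda>i. (sysB \<phi> *\<^sub>v \<theta>) $ i)"
  have w: "sysB \<phi> *\<^sub>v \<theta> \<in> carrier_vec n" and W: "W \<in> carrier_mat n n"
    using B \<theta>c by (auto simp: W_def)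
  have WT: "transpose_mat W = W" unfolding W_def by (intro eq_matI) (auto simp: mat_diag_def)
  have M: "sys_mat \<phi> \<theta> = sysA \<phi> + W" using B by (simp add: sys_mat_def W_def)
  have Mc: "sys_mat \<phi> \<theta> \<in> carrier_mat n n" unfolding M using A W by simp
  note mi = minv[OF Mc inv]
  have mit: "transpose_mat (minv (sys_mat \<phi> \<theta>)) \<in> carrier_mat n n" using mi(1) by simp
  show y: "sys_adjoint \<phi> \<theta> c \<in> carrier_vec n" unfolding sys_adjoint_def using mit c by simp
  have "transpose_mat (sys_mat \<phi> \<theta>) *\<^sub>v sys_adjoint \<phi> \<theta> c
      = (transpose_mat (sys_mat \<phi> \<theta>) * transpose_mat (minv (sys_mat \<phi> \<theta>))) *\<^sub>v c"
    unfolding sys_adjoint_def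
    using assoc_mult_mat_vec[OF transpose_carrier_mat[THEN iffD2, OF Mc] mit c] by simp
  also have "\<dots> = transpose_mat (minv (sys_mat \<phi> \<theta>) * sys_mat \<phi> \<theta>) *\<^sub>v c"
    using transpose_mult[OF mi(1) Mc] by simp
  also have "\<dots> = c" using mi(3) c by simp
  finally have "transpose_mat (sys_mat \<phi> \<theta>) *\<^sub>v sys_adjoint \<phi> \<theta> c = c" .
  moreover have "transpose_mat (sys_mat \<phi> \<theta>) = transpose_mat (sysA \<phi>) + W"
    unfolding M using transpose_add[OF A W] WT by simp
  moreover have "(transpose_mat (sysA \<phi>) + W) *\<^sub>v sys_adjoint \<phi> \<theta> c
      = transpose_mat (sysA \<phi>) *\<^sub>v sys_adjoint \<phi> \<theta> c + W *\<^sub>v sys_adjoint \<phi> \<theta> c"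
    using A by (intro add_mult_distrib_mat_vec[OF _ W y]) simp
  ultimately show "transpose_mat (sysA \<phi>) *\<^sub>v sys_adjoint \<phi> \<theta> c
      + component_mult (sysB \<phi> *\<^sub>v \<theta>) (sys_adjoint \<phi> \<theta> c) = c"
    using mat_diag_mult_vec[OF w y] by (simp add: W_def)
qed

lemma vnorm2_le_minv:
  assumes A: "A \<in> carrier_mat n n" "invertible_mat A"
    and \<kappa>: "induced_norm vnorm2 (minv A) \<le> \<kappa>" "0 \<le> \<kappa>" and v: "v \<in> carrier_vec n"
  shows "vnorm2 v \<le> \<kappa> * vnorm2 (A *\<^sub>v v)"
    and "vnorm2 v \<le> \<kappa> * vnorm2 (transpose_mat A *\<^sub>v v)"
proof -
  note mi = minv[OF A]
  have AT: "transpose_mat A \<in> carrier_mat n n" "transpose_mat (minv A) \<in> carrier_mat n n"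
    using A mi by auto
  have bound: "vnorm2 (minv A *\<^sub>v z) \<le> \<kappa> * vnorm2 z" if "z \<in> carrier_vec n" for z
  proof -
    have "vnorm2 (minv A *\<^sub>v z) \<le> induced_norm vnorm2 (minv A) * vnorm2 z"
      by (rule induced_norm_bound[OF vnorm_inf_le_vnorm2 vnorm2_le_vnorm1 mi(1) that])
    also have "\<dots> \<le> \<kappa> * vnorm2 z" using \<kappa> by (intro mult_right_mono) auto
    finally show ?thesis .
  qed
  have "v = minv A *\<^sub>v (A *\<^sub>v v)"
    using assoc_mult_mat_vec[OF mi(1) A(1) v, symmetric] mi(3) v by simp
  then show "vnorm2 v \<le> \<kappa> * vnorm2 (A *\<^sub>v v)" using bound[of "A *\<^sub>v v"] A v by simp
  have "v = transpose_mat (minv A) *\<^sub>v (transpose_mat A *\<^sub>v v)"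
    using assoc_mult_mat_vec[OF AT(2,1) v, symmetric] transpose_mult[OF A(1) mi(1), symmetric]
      mi(2) v by simp
  then show "vnorm2 v \<le> \<kappa> * vnorm2 (transpose_mat A *\<^sub>v v)"
    using vnorm2_transpose_mult_le[OF mi(1) _ \<kappa>(2) bound, of "transpose_mat A *\<^sub>v v"] AT v by simp
qed

lemma descent_run_gd:
  assumes f: "strongly_convex \<mu> f" "0 < \<mu>" "lipschitz_smooth L f" "0 < L" "bdd_below (range f)"
    and sys: "physical_system n m \<phi>" and c: "c \<in> carrier_vec n"
    and inv: "invertible_mat (sysA \<phi>)"
    and nonneg: "0 \<le> \<eta>" "0 \<le> \<kappa>" "0 \<le> \<beta>" "0 \<le> s"
    and \<kappa>: "induced_norm vnorm2 (minv (sysA \<phi>)) \<le> \<kappa>"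
    and \<beta>: "induced_norm vnorm_inf (sysB \<phi>) \<le> \<beta>" "induced_norm vnorm1 (sysB \<phi>) \<le> \<beta>"
      "induced_norm vnorm2 (sysB \<phi>) \<le> \<beta>"
    and s: "vnorm1 (sysb \<phi>) \<le> s" "vnorm1 c \<le> s"
    and run: "gd_not_fail f c \<phi> \<eta> (0\<^sub>v m) T"
  shows "descent_run f L \<mu> (sysA \<phi>) (sysB \<phi>) (sysb \<phi>) c n m T \<eta> \<kappa> \<beta> s
    (gd_iter f c \<phi> \<eta> (0\<^sub>v m)) (\<lambda>t. sys_state \<phi> (gd_iter f c \<phi> \<eta> (0\<^sub>v m) t))
    (\<lambda>t. sys_adjoint \<phi> (gd_iter f c \<phi> \<eta> (0\<^sub>v m) t) c)"
proof -
  from sys have A: "sysA \<phi> \<in> carrier_mat n n" and B: "sysB \<phi> \<in> carrier_mat n m"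
    by (auto simp: physical_system_def)
  let ?\<theta> = "gd_iter f c \<phi> \<eta> (0\<^sub>v m)"
  have dom: "?\<theta> t \<in> sys_dom \<phi>" if "t \<le> T" for t using run that by (auto simp: gd_not_fail_def)
  have B2: "vnorm2 (sysB \<phi> *\<^sub>v v) \<le> \<beta> * vnorm2 v" if "v \<in> carrier_vec m" for v
    using induced_norm_bound[OF vnorm_inf_le_vnorm2 vnorm2_le_vnorm1 B that] \<beta>(3)
    by (meson mult_right_mono order.trans vnorm2_nonneg)
  have B1: "vnorm1 (sysB \<phi> *\<^sub>v v) \<le> \<beta> * vnorm1 v" if "v \<in> carrier_vec m" for v
    using induced_norm_bound[OF vnorm_inf_le_vnorm1 order.refl B that] \<beta>(2)
    by (meson mult_right_mono order.trans vnorm1_nonneg)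
  have Binf: "vnorm_inf (sysB \<phi> *\<^sub>v v) \<le> \<beta> * vnorm_inf v" if "v \<in> carrier_vec m" for v
    using induced_norm_bound[OF order.refl vnorm_inf_le_vnorm1 B that] \<beta>(1)
    by (meson mult_right_mono order.trans vnorm_inf_nonneg)
  show ?thesis
  proof (unfold_locales)
    fix v :: "real vec" assume v: "v \<in> carrier_vec n"
    show "vnorm2 v \<le> \<kappa> * vnorm2 (sysA \<phi> *\<^sub>v v)"
      "vnorm2 v \<le> \<kappa> * vnorm2 (transpose_mat (sysA \<phi>) *\<^sub>v v)"
      by (rule vnorm2_le_minv[OF A inv \<kappa> nonneg(2) v])+
    show "vnorm2 (transpose_mat (sysB \<phi>) *\<^sub>v v) \<le> \<beta> * vnorm2 v"
      by (rule vnorm2_transpose_mult_le[OF B v nonneg(3) B2])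
    show "vnorm_inf (transpose_mat (sysB \<phi>) *\<^sub>v v) \<le> \<beta> * vnorm_inf v"
      by (rule vnorm_inf_transpose_mult_le[OF B v nonneg(3) B1])
  next
    fix t assume "t \<le> T"
    note t = dom[OF this]
    show "sys_state \<phi> (?\<theta> t) \<in> carrier_vec n"
      "sysA \<phi> *\<^sub>v sys_state \<phi> (?\<theta> t)
        + component_mult (sysB \<phi> *\<^sub>v ?\<theta> t) (sys_state \<phi> (?\<theta> t)) = sysb \<phi>"
      by (rule sys_state_equation[OF sys t])+
    show "sys_adjoint \<phi> (?\<theta> t) c \<in> carrier_vec n"
      "transpose_mat (sysA \<phi>) *\<^sub>v sys_adjoint \<phi> (?\<theta> t) c
        + component_mult (sysB \<phi> *\<^sub>v ?\<theta> t) (sys_adjoint \<phi> (?\<theta> t) c) = c"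
      by (rule sys_adjoint_equation[OF sys t c])+
  next
    fix t assume "t < T"
    then have "?\<theta> t \<in> carrier_vec m" using dom[of t] B by (auto simp: sys_dom_def)
    then show "?\<theta> (Suc t) = ?\<theta> t + (\<eta> * deriv f (c \<bullet> sys_state \<phi> (?\<theta> t))) \<cdot>\<^sub>v
        (transpose_mat (sysB \<phi>) *\<^sub>v component_mult (sys_state \<phi> (?\<theta> t)) (sys_adjoint \<phi> (?\<theta> t) c))"
      using B by (intro eq_vecI) (auto simp: objective_grad_def simp del: index_mult_mat_vec)
  qed (use f A B nonneg B2 Binf s order.trans[OF vnorm2_le_vnorm1] in simp_all)
qed

section \<open>Asymptotics\<close>

lemma eventually_powr_le:
  assumes "e < 0" and "0 < k"
  shows "\<forall>\<^sub>F n in sequentially. C * real n powr e \<le> k"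
proof -
  have "(\<lambda>n. C * real n powr e) \<longlonglongrightarrow> C * 0"
    by (intro tendsto_mult tendsto_const tendsto_neg_powr filterlim_real_sequentially assms)
  then have "\<forall>\<^sub>F n in sequentially. C * real n powr e < k" using assms by (intro order_tendstoD) auto
  then show ?thesis by eventually_elim simp
qed

lemma bigo_upper_bound:
  fixes a g :: "nat \<Rightarrow> real"
  assumes "a \<in> O(g)"
  obtains C where "0 < C" "\<forall>\<^sub>F n in sequentially. a n \<le> C * \<bar>g n\<bar>"
proof -
  from assms obtain C where "0 < C" "\<forall>\<^sub>F n in sequentially. norm (a n) \<le> C * norm (g n)"
    by (rule landau_o.bigE)
  then show ?thesis by (intro that[of C]) (auto elim: eventually_mono)
qed

lemma subpolynomial_le_powr:
  assumes "subpolynomial a" and "0 < \<delta>"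
  shows "\<forall>\<^sub>F n in sequentially. \<bar>a n\<bar> \<le> real n powr \<delta>"
proof -
  from assms obtain h where "h \<in> o(\<lambda>n. real n powr \<delta>)" "a \<in> O(h)"
    by (auto simp: subpolynomial_def)
  then have "a \<in> o(\<lambda>n. real n powr \<delta>)" by (rule landau_o.big_small_trans[rotated])
  from landau_o.smallD[OF this, of 1] show ?thesis by simp
qed

text \<open>A bound along every selection is uniform: it holds along the selection that violates it
  whenever some choice does.\<close>
lemma eventually_ball_selection:
  assumes "\<And>n. S n \<noteq> {}"
    and sel: "\<And>z. (\<And>n. z n \<in> S n) \<Longrightarrow> \<forall>\<^sub>F n in F. P n (z n)"
  shows "\<forall>\<^sub>F n in F. \<forall>z\<in>S n. P n z"
proof -
  have "\<exists>z\<in>S n. P n z \<longrightarrow> (\<forall>z\<in>S n. P n z)" for n using assms(1)[of n] by blast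
  then obtain z where z: "\<And>n. z n \<in> S n" "\<And>n. P n (z n) \<Longrightarrow> \<forall>z\<in>S n. P n z" by metis
  from sel[of z] z show ?thesis by (auto elim: eventually_mono)
qed

text \<open>The initial gap \<open>G\<close> is paid for by a constant factor in the number of steps, the same for all
  \<open>\<epsilon> \<le> \<epsilon>0\<close>, because \<open>ln G\<close> is at most a fixed multiple of \<open>ln (1 / \<epsilon>)\<close>.\<close>
lemma exp_decay_le:
  assumes "0 < \<epsilon>" "\<epsilon> \<le> \<epsilon>0" "\<epsilon>0 < 1" "1 \<le> G"
  shows "exp (- (1 + ln G / ln (1 / \<epsilon>0)) * ln (1 / \<epsilon>)) * G \<le> (\<epsilon>::real)"
proof -
  have l: "0 < ln (1 / \<epsilon>0)" "ln (1 / \<epsilon>0) \<le> ln (1 / \<epsilon>)" using assms by (auto simp: field_simps)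
  have "ln G / ln (1 / \<epsilon>0) * ln (1 / \<epsilon>0) \<le> ln G / ln (1 / \<epsilon>0) * ln (1 / \<epsilon>)"
    using assms l by (intro mult_left_mono) auto
  then have "ln (1 / \<epsilon>) + ln G \<le> (1 + ln G / ln (1 / \<epsilon>0)) * ln (1 / \<epsilon>)"
    using l by (simp add: algebra_simps)
  then have "exp (- (1 + ln G / ln (1 / \<epsilon>0)) * ln (1 / \<epsilon>)) \<le> exp (- (ln (1 / \<epsilon>) + ln G))"
    unfolding exp_le_cancel_iff mult_minus_left neg_le_iff_le .
  also have "\<dots> = \<epsilon> / G" using assms by (simp add: exp_diff exp_minus ln_div field_simps)
  finally show ?thesis using assms by (simp add: field_simps)
qed

theorem theorem1:
  fixes f :: "real \<Rightarrow> real" and c :: "nat \<Rightarrow> real vec" and \<phi> :: "nat \<Rightarrow> phys_system"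
    and \<alpha> \<gamma> \<epsilon>0 :: real and \<eta> :: "nat \<Rightarrow> real"
  assumes "design_family c \<phi>"
    and "convergence_conditions \<alpha> \<gamma> f c \<phi>"
    and "\<alpha> > 1 / 4" and "\<gamma> < 3 * \<alpha>"
    and "\<And>n. \<eta> n > 0"
    and "\<eta> \<in> O(\<lambda>n. real n powr (- 3 * \<gamma> + \<alpha> - 1))"
    and "\<eta> \<in> \<Omega>(\<lambda>n. real n powr (- 3 * \<gamma> + \<alpha> - 1))"
    and "0 < \<epsilon>0" and "\<epsilon>0 < 1"
  shows "\<exists>K>0. \<forall>\<epsilon> T.
    0 < \<epsilon> \<longrightarrow> \<epsilon> \<le> \<epsilon>0 \<longrightarrow>
    (\<forall>n. T n \<ge> (1 :: nat)) \<longrightarrow>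
    (\<lambda>n. real (T n)) \<in> \<Theta>(\<lambda>n. real n powr (1 - 2 * (\<alpha> - \<gamma>)) * ln (1 / \<epsilon>)) \<longrightarrow>
    (\<forall>\<^sub>F n in sequentially. real (T n) \<ge> K * (real n powr (1 - 2 * (\<alpha> - \<gamma>)) * ln (1 / \<epsilon>))) \<longrightarrow>
    (\<forall>n. gd_not_fail f (c n) (\<phi> n) (\<eta> n) (0\<^sub>v (dim_col (sysB (\<phi> n)))) (T n)) \<longrightarrow>
    (\<forall>\<theta>. (\<forall>n. \<theta> n \<in> gd_designs f (c n) (\<phi> n) (\<eta> n) (0\<^sub>v (dim_col (sysB (\<phi> n)))) (T n))
          \<longrightarrow> non_resonant c \<phi> \<theta>) \<longrightarrow>
    (\<forall>\<^sub>F n in sequentially.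
       f (c n \<bullet> sys_state (\<phi> n)
              (gd_iter f (c n) (\<phi> n) (\<eta> n) (0\<^sub>v (dim_col (sysB (\<phi> n)))) (T n)))
         - (INF x. f x) \<le> \<epsilon>)"
proof -
  define p q where "p = - 3 * \<gamma> + \<alpha> - 1" and "q = 1 - 2 * (\<alpha> - \<gamma>)"
  define g0 where "g0 = (\<lambda>n. transpose_mat (sysB (\<phi> n)) *\<^sub>v
    component_mult (minv (sysA (\<phi> n)) *\<^sub>v sysb (\<phi> n)) (transpose_mat (minv (sysA (\<phi> n))) *\<^sub>v c n))"
  note conds = assms(2)[unfolded convergence_conditions_def, folded g0_def]
  from conds obtain L0 \<mu> where f: "lipschitz_smooth L0 f" "0 < \<mu>" "strongly_convex \<mu> f"
    "bdd_below (range f)" by blast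
  \<comment> \<open>a Lipschitz constant that is visibly positive\<close>
  define L where "L = max L0 1"
  have "\<bar>deriv f x - deriv f y\<bar> \<le> L * \<bar>x - y\<bar>" for x y
    using f(1) mult_right_mono[of L0 L "\<bar>x - y\<bar>"]
    by (auto simp: lipschitz_smooth_def L_def intro: order.trans)
  then have L: "0 < L" "lipschitz_smooth L f"
    using f(1) by (auto simp: lipschitz_smooth_def L_def)
  from conds have inv: "\<And>n. invertible_mat (sysA (\<phi> n))" by blast
  obtain C\<^sub>A where C\<^sub>A: "0 < C\<^sub>A"
    "\<forall>\<^sub>F n in sequentially. induced_norm vnorm2 (minv (sysA (\<phi> n))) \<le> C\<^sub>A * \<bar>real n powr \<gamma>\<bar>"
    using conds by (blast elim: bigo_upper_bound)
  obtain B1 where B1: "0 < B1" "\<forall>\<^sub>F n in sequentially. induced_norm vnorm_inf (sysB (\<phi> n)) \<le> B1 * \<bar>1\<bar>"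
    using conds by (blast elim: bigo_upper_bound)
  obtain B2 where B2: "0 < B2" "\<forall>\<^sub>F n in sequentially. induced_norm vnorm1 (sysB (\<phi> n)) \<le> B2 * \<bar>1\<bar>"
    using conds by (blast elim: bigo_upper_bound)
  obtain B3 where B3: "0 < B3" "\<forall>\<^sub>F n in sequentially. induced_norm vnorm2 (sysB (\<phi> n)) \<le> B3 * \<bar>1\<bar>"
    using conds by (blast elim: bigo_upper_bound)
  obtain s1 where s1: "0 < s1" "\<forall>\<^sub>F n in sequentially. vnorm1 (sysb (\<phi> n)) \<le> s1 * \<bar>1\<bar>"
    using conds by (blast elim: bigo_upper_bound)
  obtain s2 where s2: "0 < s2" "\<forall>\<^sub>F n in sequentially. vnorm1 (c n) \<le> s2 * \<bar>1\<bar>"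
    using conds by (blast elim: bigo_upper_bound)
  obtain U where U: "0 < U"
    "\<forall>\<^sub>F n in sequentially. \<bar>c n \<bullet> (minv (sysA (\<phi> n)) *\<^sub>v sysb (\<phi> n))\<bar> \<le> U * \<bar>1\<bar>"
    using conds by (blast elim: bigo_upper_bound)
  obtain C\<^sub>g where C\<^sub>g: "0 < C\<^sub>g"
    "\<forall>\<^sub>F n in sequentially. norm ((vnorm2 (g0 n))\<^sup>2) \<ge> C\<^sub>g * norm (real n powr (\<alpha> + \<gamma>))"
    using conds unfolding g0_def by (blast elim: landau_omega.bigE)
  obtain e\<^sub>1 where e\<^sub>1: "0 < e\<^sub>1" "\<forall>\<^sub>F n in sequentially. norm (\<eta> n) \<ge> e\<^sub>1 * norm (real n powr p)"
    using assms(7) unfolding p_def by (rule landau_omega.bigE)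
  obtain e\<^sub>2 where e\<^sub>2: "0 < e\<^sub>2" "\<forall>\<^sub>F n in sequentially. \<eta> n \<le> e\<^sub>2 * \<bar>real n powr p\<bar>"
    using assms(6) unfolding p_def by (rule bigo_upper_bound)
  define \<beta> s where "\<beta> = B1 + B2 + B3" and "s = s1 + s2"
  have pos: "0 < \<beta>" "0 < s" using B1 B2 B3 s1 s2 by (auto simp: \<beta>_def s_def)
  \<comment> \<open>\<open>G\<close> bounds the initial gap, as the initial observable is at most \<open>U\<close>; the summand \<open>1\<close>
    makes \<open>ln G\<close> nonnegative. As long as the gap stays below \<open>G\<close>, the derivative stays below \<open>D\<close>.\<close>
  define G where "G = \<bar>f 0 - (INF x. f x)\<bar> + \<bar>deriv f 0\<bar> * U + L * U\<^sup>2 + 1"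
  define D where "D = sqrt (4 * L * G)"
  have G: "1 \<le> G" using U L by (simp add: G_def)
  have D: "0 \<le> D" "D\<^sup>2 = 4 * L * G" using G L by (auto simp: D_def)
  have gap_le: "f v - (INF x. f x) \<le> G" if "\<bar>v\<bar> \<le> U" for v
  proof -
    have "f v \<le> f 0 + deriv f 0 * v + L * v\<^sup>2"
      using smooth_upper_bound[OF f(3,2) L(2), of v 0] by simp
    moreover have "deriv f 0 * v \<le> \<bar>deriv f 0\<bar> * U"
      using that by (intro order.trans[OF abs_ge_self[of "deriv f 0 * v"]]) (simp add: abs_mult mult_left_mono)
    moreover have "L * v\<^sup>2 \<le> L * U\<^sup>2"
      using that L U by (intro mult_left_mono) (auto simp: abs_le_square_iff[symmetric])
    ultimately show ?thesis unfolding G_def by linarith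
  qed
  \<comment> \<open>\<open>\<omega> * ln (1 / \<epsilon>)\<close> is the exponent gained in \<open>n powr (1 - 2 * (\<alpha> - \<gamma>)) * ln (1 / \<epsilon>)\<close> steps\<close>
  define \<omega> where "\<omega> = \<mu> * e\<^sub>1 * C\<^sub>g / 8"
  define K where "K = (1 + ln G / ln (1 / \<epsilon>0)) / \<omega>"
  have \<omega>: "0 < \<omega>" using f e\<^sub>1 C\<^sub>g by (simp add: \<omega>_def)
  have K: "0 < K" unfolding K_def using \<omega> G assms(8,9) by (intro divide_pos_pos add_pos_nonneg) auto
  \<comment> \<open>\<open>n powr \<delta>\<close> stands in for the subpolynomial bounds; it enters the conditions below at most to
    the third power and must not use up the strict inequalities between the exponents\<close>
  define \<delta> where "\<delta> = min (1 / 16) (min (\<alpha> / 4) ((3 * \<alpha> - \<gamma>) / 12))"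
  have \<delta>: "0 < \<delta>" "\<delta> \<le> 1 / 16" "\<delta> \<le> \<alpha> / 4" "\<delta> \<le> (3 * \<alpha> - \<gamma>) / 12"
    using assms(3,4) unfolding \<delta>_def by (simp, linarith+)
  show ?thesis
  proof (intro exI[of _ K] conjI allI impI K)
    fix \<epsilon> :: real and T :: "nat \<Rightarrow> nat"
    assume \<epsilon>: "0 < \<epsilon>" "\<epsilon> \<le> \<epsilon>0" and T1: "\<forall>n. 1 \<le> T n"
      and T\<Theta>: "(\<lambda>n. real (T n)) \<in> \<Theta>(\<lambda>n. real n powr (1 - 2 * (\<alpha> - \<gamma>)) * ln (1 / \<epsilon>))"
      and T_ge: "\<forall>\<^sub>F n in sequentially. K * (real n powr (1 - 2 * (\<alpha> - \<gamma>)) * ln (1 / \<epsilon>)) \<le> real (T n)"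
      and run: "\<forall>n. gd_not_fail f (c n) (\<phi> n) (\<eta> n) (0\<^sub>v (dim_col (sysB (\<phi> n)))) (T n)"
      and res: "\<forall>\<theta>. (\<forall>n. \<theta> n \<in> gd_designs f (c n) (\<phi> n) (\<eta> n) (0\<^sub>v (dim_col (sysB (\<phi> n)))) (T n))
          \<longrightarrow> non_resonant c \<phi> \<theta>"
    let ?S = "\<lambda>n. gd_designs f (c n) (\<phi> n) (\<eta> n) (0\<^sub>v (dim_col (sysB (\<phi> n)))) (T n)"
    have ln_pos: "0 < ln (1 / \<epsilon>)" using \<epsilon> assms(9) by simp
    obtain \<tau>0 where "0 < \<tau>0"
      "\<forall>\<^sub>F n in sequentially. real (T n) \<le> \<tau>0 * \<bar>real n powr (1 - 2 * (\<alpha> - \<gamma>)) * ln (1 / \<epsilon>)\<bar>"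
      using T\<Theta>[THEN bigthetaD1] by (rule bigo_upper_bound)
    define \<tau> where "\<tau> = \<tau>0 * ln (1 / \<epsilon>)"
    have \<tau>: "0 < \<tau>" "\<forall>\<^sub>F n in sequentially. real (T n) \<le> \<tau> * real n powr q"
      using \<open>0 < \<tau>0\<close> \<open>\<forall>\<^sub>F n in sequentially. real (T n) \<le> \<tau>0 * _ n\<close> ln_pos
      by (simp_all add: \<tau>_def q_def abs_mult mult_ac)
    \<comment> \<open>otherwise the number of steps would tend to \<open>0\<close>\<close>
    have "0 \<le> q"
    proof (rule ccontr)
      assume "\<not> 0 \<le> q"
      then have "\<forall>\<^sub>F n in sequentially. \<tau> * real n powr q \<le> 1 / 2"
        by (intro eventually_powr_le) auto
      with \<tau>(2) have "\<forall>\<^sub>F n in sequentially. False"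
      proof eventually_elim
        case (elim n)
        with T1[rule_format, of n] show False by linarith
      qed
      then show False by simp
    qed
    then have \<alpha>\<gamma>: "\<alpha> - \<gamma> \<le> 1 / 2" by (simp add: q_def)
    have designs: "?S n \<noteq> {}" for n using T1 by (simp add: gd_designs_def)
    have x_le: "\<forall>\<^sub>F n in sequentially. \<forall>z\<in>?S n. \<bar>vnorm_inf (sys_state (\<phi> n) z)\<bar> \<le> real n powr \<delta>"
    proof (rule eventually_ball_selection[OF designs])
      fix z assume "\<And>n. z n \<in> ?S n"
      then have "subpolynomial (\<lambda>n. vnorm_inf (sys_state (\<phi> n) (z n)))"
        using res by (simp add: non_resonant_def)
      then show "\<forall>\<^sub>F n in sequentially. \<bar>vnorm_inf (sys_state (\<phi> n) (z n))\<bar> \<le> real n powr \<delta>"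
        using \<delta>(1) by (rule subpolynomial_le_powr)
    qed
    have y_le: "\<forall>\<^sub>F n in sequentially. \<forall>z\<in>?S n. \<bar>vnorm_inf (sys_adjoint (\<phi> n) z (c n))\<bar> \<le> real n powr \<delta>"
    proof (rule eventually_ball_selection[OF designs])
      fix z assume "\<And>n. z n \<in> ?S n"
      then have "subpolynomial (\<lambda>n. vnorm_inf (sys_adjoint (\<phi> n) (z n) (c n)))"
        using res by (simp add: non_resonant_def)
      then show "\<forall>\<^sub>F n in sequentially. \<bar>vnorm_inf (sys_adjoint (\<phi> n) (z n) (c n))\<bar> \<le> real n powr \<delta>"
        using \<delta>(1) by (rule subpolynomial_le_powr)
    qed
    \<comment> \<open>the conditions on a run at a fixed size, in terms of the exponents: each of these five is negative\<close>
    have start: "\<forall>\<^sub>F n in sequentially.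
        (4 * C\<^sub>A\<^sup>2 * \<beta>\<^sup>2 * D * s * e\<^sub>2) * real n powr (p + 2 * \<gamma> + \<delta>) \<le> 1 / 2"
      using \<alpha>\<gamma> \<delta> by (intro eventually_powr_le) (auto simp: p_def)
    have travel: "\<forall>\<^sub>F n in sequentially.
        (4 * C\<^sub>A * \<beta>\<^sup>2 * D * (\<tau> * e\<^sub>2)) * real n powr (q + p + \<gamma> + 2 * \<delta>) \<le> 1 / 2"
      using assms(3) \<delta> by (intro eventually_powr_le) (auto simp: p_def q_def)
    have gradient: "\<forall>\<^sub>F n in sequentially.
        (64 * C\<^sub>A\<^sup>2 * \<beta> ^ 3 * D * s * (\<tau> * e\<^sub>2)) * real n powr (q + p + 2 * \<gamma> + 3 * \<delta> - (\<alpha> + \<gamma>) / 2)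
          \<le> sqrt C\<^sub>g / 2"
      using assms(3,4) \<delta> C\<^sub>g by (intro eventually_powr_le) (auto simp: p_def q_def field_simps)
    have second_order: "\<forall>\<^sub>F n in sequentially.
        (8 * C\<^sub>A * \<beta>\<^sup>2 * D * e\<^sub>2) * real n powr (p + \<gamma> + 2 * \<delta>) \<le> 1 / 2"
      using \<alpha>\<gamma> assms(3) \<delta> by (intro eventually_powr_le) (auto simp: p_def)
    have step_size: "\<forall>\<^sub>F n in sequentially.
        (48 * L * C\<^sub>A\<^sup>2 * \<beta>\<^sup>2 * s\<^sup>2 * e\<^sub>2) * real n powr (p + 2 * \<gamma> + 2 * \<delta>) \<le> 1"
      using \<alpha>\<gamma> \<delta> by (intro eventually_powr_le) (auto simp: p_def)
    show "\<forall>\<^sub>F n in sequentially. f (c n \<bullet> sys_state (\<phi> n)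
        (gd_iter f (c n) (\<phi> n) (\<eta> n) (0\<^sub>v (dim_col (sysB (\<phi> n)))) (T n))) - (INF x. f x) \<le> \<epsilon>"
      using C\<^sub>A(2) B1(2) B2(2) B3(2) s1(2) s2(2) U(2) C\<^sub>g(2) e\<^sub>1(2) e\<^sub>2(2) \<tau>(2) T_ge x_le y_le
        start travel gradient second_order step_size eventually_gt_at_top[of 0]
    proof eventually_elim
      case (elim n)
      define N where "N = real n"
      define \<kappa> where "\<kappa> = C\<^sub>A * N powr \<gamma>"
      define r where "r = N powr \<delta>"
      \<comment> \<open>a lower bound for the initial norm of the gradient of the observable\<close>
      define \<rho> where "\<rho> = sqrt C\<^sub>g * N powr ((\<alpha> + \<gamma>) / 2)"
      define m where "m = dim_col (sysB (\<phi> n))"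
      let ?\<theta> = "gd_iter f (c n) (\<phi> n) (\<eta> n) (0\<^sub>v m)"
      have sys: "physical_system n m (\<phi> n)" and cn: "c n \<in> carrier_vec n"
        using assms(1) physical_system_dim_col by (auto simp: design_family_def m_def)
      have \<eta>: "0 < \<eta> n" "\<eta> n \<le> e\<^sub>2 * N powr p" "e\<^sub>1 * N powr p \<le> \<eta> n"
        using assms(5)[of n] elim(9,10) by (auto simp: N_def)
      have T: "real (T n) \<le> \<tau> * N powr q" "K * (N powr q * ln (1 / \<epsilon>)) \<le> real (T n)"
        using elim(11,12) by (auto simp: N_def q_def)
      have T\<eta>: "real (T n) * \<eta> n \<le> (\<tau> * e\<^sub>2) * (N powr q * N powr p)"
        using mult_mono[OF T(1) \<eta>(2)] \<eta> \<tau>(1) by (simp add: mult_ac)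
      have bounds_nonneg: "0 \<le> \<kappa>" "0 \<le> r" "0 \<le> \<rho>" using C\<^sub>A C\<^sub>g by (auto simp: \<kappa>_def r_def \<rho>_def)
      interpret descent_run f L \<mu> "sysA (\<phi> n)" "sysB (\<phi> n)" "sysb (\<phi> n)" "c n" n m "T n" "\<eta> n" \<kappa> \<beta> s
        ?\<theta> "\<lambda>t. sys_state (\<phi> n) (?\<theta> t)" "\<lambda>t. sys_adjoint (\<phi> n) (?\<theta> t) (c n)"
        by (rule descent_run_gd)
          (use f L sys cn inv bounds_nonneg \<eta> pos elim B1 B2 B3 s1 s2 run
            in \<open>auto simp: \<kappa>_def \<beta>_def s_def N_def m_def\<close>)
      have u0: "u 0 = c n \<bullet> (minv (sysA (\<phi> n)) *\<^sub>v sysb (\<phi> n))"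
        unfolding u_def by (simp add: sys_state_def sys_mat_0[OF sys])
      have g_0: "g 0 = g0 n"
        unfolding g_def by (simp add: g0_def sys_state_def sys_adjoint_def sys_mat_0[OF sys])
      have gap0: "gap 0 \<le> G" unfolding gap_def u0 using elim(7) by (intro gap_le) simp
      have "(N powr ((\<alpha> + \<gamma>) / 2))\<^sup>2 = N powr (\<alpha> + \<gamma>)"
        by (simp add: power2_eq_square powr_add[symmetric])
      then have \<rho>2: "\<rho>\<^sup>2 = C\<^sub>g * N powr (\<alpha> + \<gamma>)"
        using C\<^sub>g(1) by (simp add: \<rho>_def power_mult_distrib)
      have \<rho>_le: "\<rho> \<le> vnorm2 (g 0)"
        by (rule power2_le_imp_le) (use elim(8) in \<open>simp_all add: \<rho>2 g_0 N_def\<close>)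
      have powers: "N powr (p + 2 * \<gamma> + \<delta>) = N powr p * (N powr \<gamma>)\<^sup>2 * r"
        "N powr (q + p + \<gamma> + 2 * \<delta>) = N powr q * N powr p * N powr \<gamma> * r\<^sup>2"
        "N powr (q + p + 2 * \<gamma> + 3 * \<delta>) = N powr q * N powr p * (N powr \<gamma>)\<^sup>2 * r ^ 3"
        "N powr (p + \<gamma> + 2 * \<delta>) = N powr p * N powr \<gamma> * r\<^sup>2"
        "N powr (p + 2 * \<gamma> + 2 * \<delta>) = N powr p * (N powr \<gamma>)\<^sup>2 * r\<^sup>2"
        unfolding r_def power2_eq_square power3_eq_cube powr_add[symmetric]
        by (simp_all add: algebra_simps)
      have "gap (T n) \<le> exp (- (\<mu> * \<eta> n * \<rho>\<^sup>2 / 8) * T n) * gap 0"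
      proof (rule gap_after_run[OF T1[rule_format] _ _ D(1) _ bounds_nonneg(3) \<rho>_le])
        fix t assume t: "1 \<le> t" "t \<le> T n"
        then have "?\<theta> t \<in> ?S n" by (auto simp: gd_designs_def m_def)
        then show "vnorm_inf (sys_state (\<phi> n) (?\<theta> t)) \<le> r"
          "vnorm_inf (sys_adjoint (\<phi> n) (?\<theta> t) (c n)) \<le> r"
          using elim(13,14) by (auto simp: r_def N_def)
      next
        show "4 * L * gap 0 \<le> D\<^sup>2" unfolding D(2) using gap0 L by simp
      next
        have "4 * \<kappa>\<^sup>2 * \<beta>\<^sup>2 * \<eta> n * D * s * r = \<eta> n * (4 * \<kappa>\<^sup>2 * \<beta>\<^sup>2 * D * s * r)" by simp
        also have "\<dots> \<le> (e\<^sub>2 * N powr p) * (4 * \<kappa>\<^sup>2 * \<beta>\<^sup>2 * D * s * r)"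
          using \<eta>(2) bounds_nonneg pos D by (intro mult_right_mono) auto
        also have "\<dots> = (4 * C\<^sub>A\<^sup>2 * \<beta>\<^sup>2 * D * s * e\<^sub>2) * N powr (p + 2 * \<gamma> + \<delta>)"
          unfolding powers \<kappa>_def power_mult_distrib by (simp only: mult_ac)
        also have "\<dots> \<le> 1 / 2" unfolding N_def by (rule elim(15))
        finally show "4 * \<kappa>\<^sup>2 * \<beta>\<^sup>2 * \<eta> n * D * s * r \<le> 1 / 2" .
      next
        have "\<kappa> * \<beta> * (T n * (\<eta> n * D * \<beta> * (2 * r)\<^sup>2)) = (T n * \<eta> n) * (4 * \<kappa> * \<beta>\<^sup>2 * D * r\<^sup>2)"
          by (simp add: power2_eq_square)
        also have "\<dots> \<le> ((\<tau> * e\<^sub>2) * (N powr q * N powr p)) * (4 * \<kappa> * \<beta>\<^sup>2 * D * r\<^sup>2)"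
          using T\<eta> bounds_nonneg pos D by (intro mult_right_mono) auto
        also have "\<dots> = (4 * C\<^sub>A * \<beta>\<^sup>2 * D * (\<tau> * e\<^sub>2)) * N powr (q + p + \<gamma> + 2 * \<delta>)"
          unfolding powers \<kappa>_def power_mult_distrib by (simp only: mult_ac)
        also have "\<dots> \<le> 1 / 2" unfolding N_def by (rule elim(16))
        finally show "\<kappa> * \<beta> * (T n * (\<eta> n * D * \<beta> * (2 * r)\<^sup>2)) \<le> 1 / 2" .
      next
        let ?h = "(\<alpha> + \<gamma>) / 2"
        have "4 * \<kappa> * \<beta>\<^sup>2 * (T n * (\<eta> n * D * (\<beta> * (2 * \<kappa> * s * (2 * r))))) * (2 * r)\<^sup>2
            = (T n * \<eta> n) * (64 * \<kappa>\<^sup>2 * \<beta> ^ 3 * D * s * r ^ 3)"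
          by (simp add: power2_eq_square power3_eq_cube)
        also have "\<dots> \<le> ((\<tau> * e\<^sub>2) * (N powr q * N powr p)) * (64 * \<kappa>\<^sup>2 * \<beta> ^ 3 * D * s * r ^ 3)"
          using T\<eta> bounds_nonneg pos D by (intro mult_right_mono) auto
        also have "\<dots> = (64 * C\<^sub>A\<^sup>2 * \<beta> ^ 3 * D * s * (\<tau> * e\<^sub>2)) * N powr (q + p + 2 * \<gamma> + 3 * \<delta>)"
          unfolding powers \<kappa>_def power_mult_distrib by (simp only: mult_ac)
        also have "N powr (q + p + 2 * \<gamma> + 3 * \<delta>) = N powr (q + p + 2 * \<gamma> + 3 * \<delta> - ?h) * N powr ?h"
          by (simp add: powr_add[symmetric])
        also have "(64 * C\<^sub>A\<^sup>2 * \<beta> ^ 3 * D * s * (\<tau> * e\<^sub>2)) * (N powr (q + p + 2 * \<gamma> + 3 * \<delta> - ?h) * N powr ?h)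
            \<le> sqrt C\<^sub>g / 2 * N powr ?h"
          unfolding mult.assoc[of _ "N powr (q + p + 2 * \<gamma> + 3 * \<delta> - ?h)", symmetric]
          using elim(17) by (intro mult_right_mono) (auto simp: N_def)
        finally show "4 * \<kappa> * \<beta>\<^sup>2 * (T n * (\<eta> n * D * (\<beta> * (2 * \<kappa> * s * (2 * r))))) * (2 * r)\<^sup>2 \<le> \<rho> / 2"
          by (simp add: \<rho>_def)
      next
        have "2 * \<kappa> * \<beta>\<^sup>2 * (2 * r)\<^sup>2 * \<eta> n * D = \<eta> n * (8 * \<kappa> * \<beta>\<^sup>2 * D * r\<^sup>2)"
          by (simp add: power2_eq_square)
        also have "\<dots> \<le> (e\<^sub>2 * N powr p) * (8 * \<kappa> * \<beta>\<^sup>2 * D * r\<^sup>2)"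
          using \<eta>(2) bounds_nonneg pos D by (intro mult_right_mono) auto
        also have "\<dots> = (8 * C\<^sub>A * \<beta>\<^sup>2 * D * e\<^sub>2) * N powr (p + \<gamma> + 2 * \<delta>)"
          unfolding powers \<kappa>_def power_mult_distrib by (simp only: mult_ac)
        also have "\<dots> \<le> 1 / 2" unfolding N_def by (rule elim(18))
        finally show "2 * \<kappa> * \<beta>\<^sup>2 * (2 * r)\<^sup>2 * \<eta> n * D \<le> 1 / 2" .
      next
        have "3 * L * \<eta> n * (\<beta> * (2 * \<kappa> * s * (2 * r)))\<^sup>2 = \<eta> n * (48 * L * \<kappa>\<^sup>2 * \<beta>\<^sup>2 * s\<^sup>2 * r\<^sup>2)"
          by (simp add: power2_eq_square)
        also have "\<dots> \<le> (e\<^sub>2 * N powr p) * (48 * L * \<kappa>\<^sup>2 * \<beta>\<^sup>2 * s\<^sup>2 * r\<^sup>2)"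
          using \<eta>(2) bounds_nonneg pos L by (intro mult_right_mono) auto
        also have "\<dots> = (48 * L * C\<^sub>A\<^sup>2 * \<beta>\<^sup>2 * s\<^sup>2 * e\<^sub>2) * N powr (p + 2 * \<gamma> + 2 * \<delta>)"
          unfolding powers \<kappa>_def power_mult_distrib by (simp only: mult_ac)
        also have "\<dots> \<le> 1" unfolding N_def by (rule elim(19))
        finally show "3 * L * \<eta> n * (\<beta> * (2 * \<kappa> * s * (2 * r)))\<^sup>2 \<le> 1" .
      qed
      also have "\<dots> \<le> exp (- (1 + ln G / ln (1 / \<epsilon>0)) * ln (1 / \<epsilon>)) * G"
      proof (rule mult_mono[OF _ gap0])
        have "(1 + ln G / ln (1 / \<epsilon>0)) * ln (1 / \<epsilon>) = \<omega> * K * ln (1 / \<epsilon>)"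
          using \<omega> by (simp add: K_def)
        also have "\<dots> = \<mu> * (e\<^sub>1 * N powr p) * (C\<^sub>g * N powr (\<alpha> + \<gamma>)) / 8 * (K * (N powr q * ln (1 / \<epsilon>)))"
        proof -
          have "N powr p * N powr (\<alpha> + \<gamma>) * N powr q = 1"
            using elim(20) by (simp add: N_def p_def q_def powr_add[symmetric])
          moreover have "\<mu> * (e\<^sub>1 * N powr p) * (C\<^sub>g * N powr (\<alpha> + \<gamma>)) / 8 * (K * (N powr q * ln (1 / \<epsilon>)))
              = \<omega> * K * ln (1 / \<epsilon>) * (N powr p * N powr (\<alpha> + \<gamma>) * N powr q)"
            by (simp add: \<omega>_def)
          ultimately show ?thesis by (simp only: mult_1_right)
        qed
        also have "\<dots> \<le> \<mu> * \<eta> n * \<rho>\<^sup>2 / 8 * T n"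
          unfolding \<rho>2 using \<eta> T f C\<^sub>g e\<^sub>1 K ln_pos
          by (intro mult_mono divide_right_mono mult_left_mono) auto
        finally show "exp (- (\<mu> * \<eta> n * \<rho>\<^sup>2 / 8) * T n) \<le> exp (- (1 + ln G / ln (1 / \<epsilon>0)) * ln (1 / \<epsilon>))"
          unfolding exp_le_cancel_iff mult_minus_left neg_le_iff_le .
      qed (use gap_nonneg in auto)
      also have "\<dots> \<le> \<epsilon>" using \<epsilon> assms(9) G by (rule exp_decay_le)
      finally show ?case unfolding gap_def u_def unfolding m_def .
    qed
  qed
qed

end
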